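(* Let $\lambda\ge 0$ and $\mu_1\in\mathbb{R}$ be real constants and let $n$ be an integer with $2\le n\le 4$. Then there exists a unique function $h\in C^2((0,\infty))\cap C^1([0,\infty))$ satisfying $$2r^2h(r)h_{rr}(r)=(n-1)h(r)(h(r)-1)+rh_r(r)\big(rh_r(r)-\lambda r-(n-1)\big),\qquad h(r)>0,\qquad \forall r>0,$$ together with $h(0)=1$ and $h_r(0)=\mu_1$.
   Context: Functions are real-valued; $h_r$ and $h_{rr}$ denote the first and second derivatives of $h$ in $r$. $C^1([0,\infty))$ means continuously differentiable up to $r=0$, with $h_r(0)$ the one-sided derivative at $0$. *)

theory Defs
  imports "HOL-Analysis.Analysis"
begin

(* Differentiation is relative to S, hence one-sided at an endpoint belonging to S; the values
   of f outside S play no role. Intended for S on which derivatives within S are unique, such as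
   open sets and nondegenerate intervals. *)
fun Ck_on :: "nat \<Rightarrow> real set \<Rightarrow> (real \<Rightarrow> real) \<Rightarrow> bool" where
  "Ck_on 0 S f = continuous_on S f"
| "Ck_on (Suc k) S f =
     (f differentiable_on S \<and> Ck_on k S (\<lambda>x. vector_derivative f (at x within S)))"

(* For r > 0 the numbers deriv h r and deriv (deriv h) r depend only on h on the positive reals.
   The condition at 0 is on the one-sided derivative. *)
definition profile_solution :: "real \<Rightarrow> real \<Rightarrow> int \<Rightarrow> (real \<Rightarrow> real) \<Rightarrow> bool" where
  "profile_solution lam \<mu>\<^sub>1 n h \<longleftrightarrow>
     Ck_on 2 {0<..} h \<and> Ck_on 1 {0..} h \<and>
     (\<forall>r>0. 2 * r^2 * h r * deriv (deriv h) r =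
              (of_int n - 1) * h r * (h r - 1) +
              r * deriv h r * (r * deriv h r - lam * r - (of_int n - 1)) \<and>
            h r > 0) \<and>
     h 0 = 1 \<and> (h has_real_derivative \<mu>\<^sub>1) (at 0 within {0..})"

end

theory Submission
  imports Defs
begin

text \<open>
  Put \<open>m = n - 1\<close>, \<open>h = w\<^sup>2\<close>, \<open>w = 1 + r v\<close> and \<open>x = w'\<close>. The equation becomes
  \<open>w'' = m (w - 1/w)/(4r\<^sup>2) - (lam/2 + m/(2r)) w'/w\<^sup>2\<close>. Its linearisation at \<open>w = 1\<close> has the
  exponents \<open>1\<close> and \<open>-m/2\<close> at the origin, and for \<open>A = x + (m/2) v\<close> the singular terms cancel:
  \<open>A' = G(r, v, A)\<close> with \<open>G\<close> smooth as long as \<open>w > 0\<close>, while \<open>r v' = A - (1 + m/2) v\<close>. The latter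
  says that \<open>v\<close> is a weighted mean of \<open>A\<close> over \<open>[0, r]\<close>, so the problem is a Volterra equation for
  \<open>A\<close>, which is uniquely solvable on every \<open>[0, R]\<close> when \<open>G\<close> is globally Lipschitz, by a contraction
  in a norm with weight \<open>exp (- L r)\<close>. Clipping the arguments of \<open>G\<close> makes it globally Lipschitz, and
  a priori bounds for \<open>w\<close> and \<open>w'\<close> on compact intervals show that the clipping is never active.
\<close>

section \<open>A singular linear equation\<close>

lemma increment_mono:
  fixes f g :: "real \<Rightarrow> real"
  assumes "a \<le> b" "continuous_on {a..b} f" "continuous_on {a..b} g"
    and "\<And>x. a < x \<Longrightarrow> x < b \<Longrightarrow> (f has_real_derivative f' x) (at x)"
    and "\<And>x. a < x \<Longrightarrow> x < b \<Longrightarrow> (g has_real_derivative g' x) (at x)"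
    and "\<And>x. a < x \<Longrightarrow> x < b \<Longrightarrow> f' x \<le> g' x"
  shows "f b - f a \<le> g b - g a"
proof -
  have "(\<lambda>x. g x - f x) a \<le> (\<lambda>x. g x - f x) b"
  proof (rule DERIV_nonneg_imp_increasing_open[OF assms(1)])
    show "\<exists>y. ((\<lambda>x. g x - f x) has_real_derivative y) (at x) \<and> 0 \<le> y" if "a < x" "x < b" for x
      using DERIV_diff[OF assms(5)[OF that] assms(4)[OF that]] assms(6)[OF that] by force
    show "continuous_on {a..b} (\<lambda>x. g x - f x)"
      by (intro continuous_intros assms)
  qed
  then show ?thesis by simp
qed

lemma integral_has_real_derivative_interior:
  fixes f :: "real \<Rightarrow> real"
  assumes "continuous_on {a..b} f" "a < x" "x < b"
  shows "((\<lambda>x. integral {a..x} f) has_real_derivative f x) (at x)"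
  using integral_has_real_derivative[OF assms(1), of x] assms by (simp add: at_within_Icc_at)

text \<open>The comparison function \<open>r powr \<kappa> * (M * exp (L * r) / \<kappa>)\<close>
  vanishes at 0 and its derivative exceeds \<open>s powr (\<kappa> - 1) * (M * exp (L * s))\<close>,
  because differentiating the exponential only adds a nonnegative term. Carrying the weight
  \<open>exp (L * s)\<close> here makes the estimate usable in the weighted norm of the
  contraction.\<close>

lemma powr_primitive_bound:
  fixes P A :: "real \<Rightarrow> real"
  assumes "\<kappa> > 0" "L \<ge> 0" "M \<ge> 0" "r \<ge> 0"
    and "continuous_on {0..r} P" "P 0 = 0"
    and P': "\<And>s. 0 < s \<Longrightarrow> s < r \<Longrightarrow> (P has_real_derivative s powr (\<kappa> - 1) * A s) (at s)"
    and A: "\<And>s. 0 < s \<Longrightarrow> s < r \<Longrightarrow> \<bar>A s\<bar> \<le> M * exp (L * s)"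
  shows "\<bar>P r\<bar> \<le> r powr \<kappa> * (M * exp (L * r) / \<kappa>)"
proof -
  define B where "B s = s powr \<kappa> * (M * exp (L * s) / \<kappa>)" for s
  define B' where "B' s = s powr (\<kappa> - 1) * (M * exp (L * s)) + s powr \<kappa> * (M * L * exp (L * s) / \<kappa>)" for s
  have contB: "continuous_on {0..r} B"
    unfolding B_def using \<open>\<kappa> > 0\<close> by (intro continuous_intros continuous_on_powr') auto
  have derB: "(B has_real_derivative B' s) (at s)" if "0 < s" for s
    unfolding B_def B'_def using that \<open>\<kappa> > 0\<close>
    by (auto intro!: derivative_eq_intros simp: field_simps)
  have B'_ge: "s powr (\<kappa> - 1) * (M * exp (L * s)) \<le> B' s" for s
    unfolding B'_def using assms(1-3) by simp
  have le: "\<bar>s powr (\<kappa> - 1) * A s\<bar> \<le> B' s" if "0 < s" "s < r" for s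
    using mult_left_mono[OF A[OF that], of "s powr (\<kappa> - 1)"] B'_ge[of s] by (simp add: abs_mult)
  have "P r - P 0 \<le> B r - B 0"
    using assms(4,5) contB P' derB le
    by (intro increment_mono[where f' = "\<lambda>s. s powr (\<kappa> - 1) * A s" and g' = B']) (auto simp: abs_le_iff)
  moreover have "(- P r) - (- P 0) \<le> B r - B 0"
    using assms(4,5) contB P' derB le
    by (intro increment_mono[where f' = "\<lambda>s. - (s powr (\<kappa> - 1) * A s)" and g' = B'])
       (auto simp: abs_le_iff intro: continuous_intros DERIV_minus)
  moreover have "B 0 = 0" by (simp add: B_def)
  ultimately show ?thesis using assms(6) by (simp add: B_def)
qed

text \<open>The singular linear equation \<open>r v' = A - \<kappa> v\<close>: its only solution that is bounded at
  the origin is the weighted mean of \<open>A\<close>, which inherits sup-bounds from \<open>A\<close>.\<close>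

definition mean_solution :: "real \<Rightarrow> real \<Rightarrow> (real \<Rightarrow> real) \<Rightarrow> (real \<Rightarrow> real) \<Rightarrow> bool" where
  "mean_solution \<kappa> R A v \<longleftrightarrow> continuous_on {0..R} v \<and> v 0 = A 0 / \<kappa> \<and>
     (\<forall>r. 0 < r \<longrightarrow> r < R \<longrightarrow> (v has_real_derivative (A r - \<kappa> * v r) / r) (at r))"

text \<open>The integrating factor \<open>s powr \<kappa>\<close> turns the equation into
  (s^\<kappa> v)' = s^(\<kappa>-1) A, whose primitive vanishes at 0; the previous bound then
  applies. At r = 0 the prescribed value \<open>A 0 / \<kappa>\<close> settles the claim.\<close>

lemma mean_solution_bound:
  assumes "mean_solution \<kappa> R A v" "\<kappa> > 0" "L \<ge> 0" "0 \<le> r" "r \<le> R"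
    and A: "\<And>s. 0 \<le> s \<Longrightarrow> s \<le> R \<Longrightarrow> \<bar>A s\<bar> \<le> M * exp (L * s)"
  shows "\<bar>v r\<bar> \<le> M * exp (L * r) / \<kappa>"
proof (cases "r = 0")
  case True
  then show ?thesis
    using assms A[of 0] by (simp add: mean_solution_def divide_right_mono)
next
  case False
  have M: "M \<ge> 0" using A[of 0] assms by simp
  have cont: "continuous_on {0..r} v"
    using assms by (auto simp: mean_solution_def elim: continuous_on_subset)
  have "\<bar>(\<lambda>s. s powr \<kappa> * v s) r\<bar> \<le> r powr \<kappa> * (M * exp (L * r) / \<kappa>)"
  proof (rule powr_primitive_bound[where A = A])
    show "continuous_on {0..r} (\<lambda>s. s powr \<kappa> * v s)"
      using \<open>\<kappa> > 0\<close> by (intro continuous_intros continuous_on_powr' cont) auto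
    fix s assume s: "0 < s" "s < r"
    then have *: "(v has_real_derivative (A s - \<kappa> * v s) / s) (at s)"
      using assms by (auto simp: mean_solution_def)
    have "s powr \<kappa> = s * s powr (\<kappa> - 1)"
      using s by (simp add: powr_mult_base)
    then show "((\<lambda>s. s powr \<kappa> * v s) has_real_derivative s powr (\<kappa> - 1) * A s) (at s)"
      using s by (auto intro!: derivative_eq_intros * simp: field_simps)
  qed (use assms M in auto)
  then have "r powr \<kappa> * \<bar>v r\<bar> \<le> r powr \<kappa> * (M * exp (L * r) / \<kappa>)"
    by (simp add: abs_mult)
  then show ?thesis using False by (subst (asm) mult_le_cancel_left_pos) auto
qed

lemma mean_solution_diff:
  assumes "mean_solution \<kappa> R A v" "mean_solution \<kappa> R B w"
  shows "mean_solution \<kappa> R (\<lambda>s. A s - B s) (\<lambda>s. v s - w s)"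
  using assms unfolding mean_solution_def
  by (auto intro!: continuous_intros derivative_eq_intros simp: diff_divide_distrib add_divide_distrib algebra_simps)

text \<open>The solution is r^(-\<kappa>) times the integral of s^(\<kappa>-1) A(s) over [0, r],
  extended to 0 by its limit. With \<kappa> > 1 the integrand is continuous up to the origin. The
  real work is continuity of the quotient at 0.\<close>

lemma mean_solution_exists:
  assumes A: "continuous_on {0..R} A" and \<kappa>: "\<kappa> > 1"
  shows "\<exists>v. mean_solution \<kappa> R A v"
proof -
  define P where "P B r = integral {0..r} (\<lambda>s. s powr (\<kappa> - 1) * B s)" for B and r :: real
  define v where "v r = (if r = 0 then A 0 / \<kappa> else P A r / r powr \<kappa>)" for r
  have cont: "continuous_on {0..R} (\<lambda>s. s powr (\<kappa> - 1) * B s)" if "continuous_on {0..R} B" for B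
    using \<kappa> that by (intro continuous_intros continuous_on_powr') auto
  have int: "(\<lambda>s. s powr (\<kappa> - 1) * B s) integrable_on {0..r}"
    if "continuous_on {0..R} B" "r \<le> R" for B r
    using continuous_on_subset[OF cont[OF that(1)], of "{0..r}"] that(2)
    by (intro integrable_continuous_interval) auto
  have contP: "continuous_on {0..R} (P B)" if "continuous_on {0..R} B" for B
    unfolding P_def using int[OF that] by (intro indefinite_integral_continuous_1) auto
  have derP: "(P B has_real_derivative s powr (\<kappa> - 1) * B s) (at s)"
    if "continuous_on {0..R} B" "0 < s" "s < R" for B s
    unfolding P_def by (rule integral_has_real_derivative_interior[OF cont[OF that(1)] that(2,3)])
  have P0: "P B 0 = 0" for B by (simp add: P_def)
  have const: "P (\<lambda>_. c) r = r powr \<kappa> * (c / \<kappa>)" if "0 < r" "r \<le> R" for c r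
  proof -
    have "((\<lambda>s. s powr (\<kappa> - 1) * c) has_integral (r powr \<kappa> * (c / \<kappa>) - 0 powr \<kappa> * (c / \<kappa>))) {0..r}"
      using that \<kappa>
      by (intro fundamental_theorem_of_calculus_interior continuous_intros continuous_on_powr')
         (auto simp flip: has_real_derivative_iff_has_vector_derivative intro!: derivative_eq_intros)
    then show ?thesis unfolding P_def by (subst integral_unique) auto
  qed
  \<comment> \<open>The constant \<open>A 0\<close> has the exact mean
    \<open>A 0 / \<kappa>\<close>. Subtracting it reduces continuity at the origin to the smallness
    of \<open>A s - A 0\<close> near 0.\<close>
  have near0: "\<bar>v r - A 0 / \<kappa>\<bar> \<le> \<epsilon>"
    if r: "0 < r" "r \<le> R" and \<epsilon>: "\<epsilon> \<ge> 0" "\<And>s. 0 < s \<Longrightarrow> s < r \<Longrightarrow> \<bar>A s - A 0\<bar> \<le> \<epsilon>" for r \<epsilon>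
  proof -
    have cA: "continuous_on {0..R} (\<lambda>s. A s - A 0)" by (intro continuous_intros A)
    have "\<bar>P (\<lambda>s. A s - A 0) r\<bar> \<le> r powr \<kappa> * (\<epsilon> * exp (0 * r) / \<kappa>)"
      using r \<epsilon> \<kappa> by (intro powr_primitive_bound[where A = "\<lambda>s. A s - A 0"] derP P0 cA
          continuous_on_subset[OF contP[OF cA]]) auto
    moreover have "P (\<lambda>s. A s - A 0) r = P A r - P (\<lambda>_. A 0) r"
      unfolding P_def right_diff_distrib using int[OF A r(2)] int[OF continuous_on_const r(2)]
      by (rule integral_diff)
    ultimately have "\<bar>P A r - r powr \<kappa> * (A 0 / \<kappa>)\<bar> \<le> r powr \<kappa> * (\<epsilon> / \<kappa>)"
      using r by (simp add: const)
    moreover have "P A r - r powr \<kappa> * (A 0 / \<kappa>) = r powr \<kappa> * (v r - A 0 / \<kappa>)"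
      using r by (simp add: v_def right_diff_distrib)
    ultimately have "r powr \<kappa> * \<bar>v r - A 0 / \<kappa>\<bar> \<le> r powr \<kappa> * (\<epsilon> / \<kappa>)"
      by (simp add: abs_mult)
    then have "\<bar>v r - A 0 / \<kappa>\<bar> \<le> \<epsilon> / \<kappa>"
      using r by (subst (asm) mult_le_cancel_left_pos) auto
    also have "\<epsilon> / \<kappa> \<le> \<epsilon>" using \<kappa> \<epsilon>(1) mult_left_mono[of 1 \<kappa> \<epsilon>] by (simp add: divide_le_eq)
    finally show ?thesis .
  qed
  have derv: "(v has_real_derivative (A r - \<kappa> * v r) / r) (at r)" if r: "0 < r" "r < R" for r
  proof -
    have eq: "r powr \<kappa> = r * r powr (\<kappa> - 1)"
      using r by (simp add: powr_mult_base)
    have "((\<lambda>r. P A r / r powr \<kappa>) has_real_derivative (A r - \<kappa> * v r) / r) (at r)"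
      using r by (auto intro!: derivative_eq_intros derP[OF A] simp: v_def eq field_simps)
    then show ?thesis
      by (rule has_field_derivative_transform_within[where d = r]) (use r in \<open>auto simp: v_def dist_real_def\<close>)
  qed
  have "continuous_on {0..R} v"
  proof (cases "R > 0")
    case True
    have "continuous (at x within {0..R}) v" if "x \<in> {0..R}" for x
    proof (cases "x = 0")
      case True
      show ?thesis unfolding continuous_within_eps_delta
      proof (intro allI impI)
        fix e :: real assume "e > 0"
        then obtain d where d: "d > 0" "\<And>s. s \<in> {0..R} \<Longrightarrow> dist s 0 < d \<Longrightarrow> dist (A s) (A 0) < e / 2"
          using A \<open>R > 0\<close> unfolding continuous_on_iff by (metis half_gt_zero atLeastAtMost_iff less_eq_real_def)
        have "dist (v s) (v x) < e" if s: "s \<in> {0..R}" "dist s x < d" for s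
        proof (cases "s = 0")
          case False
          have "\<bar>v s - A 0 / \<kappa>\<bar> \<le> e / 2"
          proof (rule near0)
            show "\<bar>A t - A 0\<bar> \<le> e / 2" if "0 < t" "t < s" for t
              using d(2)[of t] s that True by (auto simp: dist_real_def)
          qed (use s False True \<open>e > 0\<close> in auto)
          then show ?thesis using True \<open>e > 0\<close> by (simp add: dist_real_def v_def)
        qed (use True \<open>e > 0\<close> in auto)
        then show "\<exists>d>0. \<forall>s\<in>{0..R}. dist s x < d \<longrightarrow> dist (v s) (v x) < e" using d(1) by blast
      qed
    next
      case False
      have "continuous (at x within {0..R}) (\<lambda>r. P A r / r powr \<kappa>)"
        using contP[OF A] that False
        by (intro continuous_intros) (auto simp: continuous_on_eq_continuous_within continuous_within)
      then show ?thesis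
        by (rule continuous_transform_within[where \<delta> = x]) (use that False in \<open>auto simp: v_def dist_real_def\<close>)
    qed
    then show ?thesis by (simp add: continuous_on_eq_continuous_within)
  next
    case False
    then have "{0..R} \<subseteq> {0}" by auto
    then show ?thesis by (rule continuous_on_subset[OF continuous_on_sing])
  qed
  then have "mean_solution \<kappa> R A v"
    using derv by (simp add: mean_solution_def v_def)
  then show ?thesis by blast
qed

section \<open>The singular Volterra problem\<close>

text \<open>Since \<open>mean_solution\<close> forces \<open>v 0 = A 0 / \<kappa>\<close>, the
  condition on \<open>A 0\<close> encodes v(0) = b. Derivatives are required only in the open
  interval; continuity takes care of the endpoints.\<close>

definition singular_ivp ::
  "real \<Rightarrow> real \<Rightarrow> real \<Rightarrow> (real \<Rightarrow> real \<Rightarrow> real \<Rightarrow> real) \<Rightarrow> (real \<Rightarrow> real) \<Rightarrow> (real \<Rightarrow> real) \<Rightarrow> bool" where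
  "singular_ivp \<kappa> b R G v A \<longleftrightarrow> continuous_on {0..R} A \<and> A 0 = \<kappa> * b \<and> mean_solution \<kappa> R A v \<and>
     (\<forall>r. 0 < r \<longrightarrow> r < R \<longrightarrow> (A has_real_derivative G r (v r) (A r)) (at r))"

lemma singular_ivp_restrict:
  assumes "singular_ivp \<kappa> b R G v A" "S \<le> R"
  shows "singular_ivp \<kappa> b S G v A"
  using assms unfolding singular_ivp_def mean_solution_def
  by (auto intro: continuous_on_subset[where s = "{0..R}"])

lemma singular_ivp_cong:
  assumes "singular_ivp \<kappa> b R G v A"
    and "\<And>r. 0 < r \<Longrightarrow> r < R \<Longrightarrow> G r (v r) (A r) = H r (v r) (A r)"
  shows "singular_ivp \<kappa> b R H v A"
  using assms unfolding singular_ivp_def by auto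

text \<open>If A and B differ by at most M exp (L s), the mean bound gives the same for v and w, so
  the right-hand sides differ by at most 2 K M exp (L s). Integration gains a factor 1/L, and L >= 4
  K makes the total factor at most 1/2. C and D are kept separate from A and B so that the estimate
  serves both uniqueness (C = A, D = B) and Picard iteration.\<close>

lemma volterra_contraction:
  assumes K: "\<And>r v A w B. 0 \<le> r \<Longrightarrow> r \<le> R \<Longrightarrow> \<bar>G r v A - G r w B\<bar> \<le> K * (\<bar>v - w\<bar> + \<bar>A - B\<bar>)"
    and "K \<ge> 0" "\<kappa> \<ge> 1" "L > 0" "4 * K \<le> L"
    and mean: "mean_solution \<kappa> R A v" "mean_solution \<kappa> R B w"
    and close: "\<And>s. 0 \<le> s \<Longrightarrow> s \<le> R \<Longrightarrow> \<bar>A s - B s\<bar> \<le> M * exp (L * s)"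
    and C: "continuous_on {0..R} C" "\<And>r. 0 < r \<Longrightarrow> r < R \<Longrightarrow> (C has_real_derivative G r (v r) (A r)) (at r)"
    and D: "continuous_on {0..R} D" "\<And>r. 0 < r \<Longrightarrow> r < R \<Longrightarrow> (D has_real_derivative G r (w r) (B r)) (at r)"
    and "C 0 = D 0" and r: "0 \<le> r" "r \<le> R"
  shows "\<bar>C r - D r\<bar> \<le> M / 2 * exp (L * r)"
proof -
  have M: "M \<ge> 0" using close[of 0] r by simp
  define E where "E s = M / 2 * exp (L * s)" for s
  have E': "(E has_real_derivative M / 2 * L * exp (L * s)) (at s)" for s
    unfolding E_def by (auto intro!: derivative_eq_intros)
  have contE: "continuous_on {0..r} E" unfolding E_def by (intro continuous_intros)
  have G: "\<bar>G s (v s) (A s) - G s (w s) (B s)\<bar> \<le> M / 2 * L * exp (L * s)" if "0 < s" "s < r" for s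
  proof -
    have "\<bar>v s - w s\<bar> \<le> M * exp (L * s) / \<kappa>"
      using mean_solution_bound[OF mean_solution_diff[OF mean], of L s M] close that assms by simp
    also have "\<dots> \<le> M * exp (L * s)"
      using \<open>\<kappa> \<ge> 1\<close> M mult_left_mono[of 1 \<kappa> "M * exp (L * s)"] by (simp add: divide_le_eq)
    finally have "\<bar>v s - w s\<bar> + \<bar>A s - B s\<bar> \<le> 2 * (M * exp (L * s))"
      using close[of s] that r by simp
    then have "K * (\<bar>v s - w s\<bar> + \<bar>A s - B s\<bar>) \<le> K * (2 * (M * exp (L * s)))"
      using \<open>K \<ge> 0\<close> by (rule mult_left_mono)
    also have "\<dots> = 4 * K * (M / 2 * exp (L * s))" by simp
    also have "\<dots> \<le> L * (M / 2 * exp (L * s))" using assms(5) M by (intro mult_right_mono) auto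
    finally show ?thesis using K[of s "v s" "A s" "w s" "B s"] that r by (simp add: algebra_simps)
  qed
  have G1: "G s (v s) (A s) - G s (w s) (B s) \<le> M / 2 * L * exp (L * s)"
    and G2: "G s (w s) (B s) - G s (v s) (A s) \<le> M / 2 * L * exp (L * s)" if "0 < s" "s < r" for s
    using abs_le_D1[OF G[OF that]] abs_le_D2[OF G[OF that]] by auto
  have contCD: "continuous_on {0..r} (\<lambda>s. C s - D s)" "continuous_on {0..r} (\<lambda>s. D s - C s)"
    using C(1) D(1) r by (auto intro!: continuous_intros elim: continuous_on_subset)
  have "(C r - D r) - (C 0 - D 0) \<le> E r - E 0"
    using r by (intro increment_mono[OF _ contCD(1) contE DERIV_diff[OF C(2) D(2)] E' G1]) auto
  moreover have "(D r - C r) - (D 0 - C 0) \<le> E r - E 0"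
    using r by (intro increment_mono[OF _ contCD(2) contE DERIV_diff[OF D(2) C(2)] E' G2]) auto
  moreover have "E 0 \<ge> 0" using M by (simp add: E_def)
  ultimately show ?thesis using \<open>C 0 = D 0\<close> unfolding E_def abs_le_iff by linarith
qed

text \<open>Two solutions are their own Picard images. At a maximum point of the weighted difference
  \<open>u\<close> the contraction gives u <= u/2, so the maximum is 0.\<close>

lemma singular_ivp_unique:
  assumes K: "\<And>r v A w B. 0 \<le> r \<Longrightarrow> r \<le> R \<Longrightarrow> \<bar>G r v A - G r w B\<bar> \<le> K * (\<bar>v - w\<bar> + \<bar>A - B\<bar>)"
    and "K \<ge> 0" "\<kappa> \<ge> 1"
    and sol: "singular_ivp \<kappa> b R G v A" "singular_ivp \<kappa> b R G w B"
    and r: "0 \<le> r" "r \<le> R"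
  shows "v r = w r" "A r = B r"
proof -
  define L where "L = 4 * K + 1"
  have L: "L > 0" "4 * K \<le> L" using \<open>K \<ge> 0\<close> by (auto simp: L_def)
  define u where "u s = \<bar>A s - B s\<bar> * exp (- L * s)" for s
  have "continuous_on {0..R} u"
    using sol unfolding u_def singular_ivp_def by (intro continuous_intros) auto
  then obtain s\<^sub>0 where s\<^sub>0: "s\<^sub>0 \<in> {0..R}" "\<And>s. s \<in> {0..R} \<Longrightarrow> u s \<le> u s\<^sub>0"
    using continuous_attains_sup[of "{0..R}" u] r by auto
  have close: "\<bar>A s - B s\<bar> \<le> u s\<^sub>0 * exp (L * s)" if "0 \<le> s" "s \<le> R" for s
    using s\<^sub>0(2)[of s] that by (simp add: u_def exp_minus field_simps)
  have mean: "mean_solution \<kappa> R A v" "mean_solution \<kappa> R B w"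
    using sol by (auto simp: singular_ivp_def)
  have "\<bar>A s\<^sub>0 - B s\<^sub>0\<bar> \<le> u s\<^sub>0 / 2 * exp (L * s\<^sub>0)"
    using sol s\<^sub>0(1)
    by (intro volterra_contraction[OF K \<open>K \<ge> 0\<close> \<open>\<kappa> \<ge> 1\<close> L mean close]) (auto simp: singular_ivp_def)
  then have "u s\<^sub>0 \<le> u s\<^sub>0 / 2"
    by (simp add: u_def exp_minus field_simps)
  moreover have "u s\<^sub>0 \<ge> 0" by (simp add: u_def)
  ultimately have "u s\<^sub>0 = 0" by simp
  then have close: "\<bar>A s - B s\<bar> \<le> 0 * exp (L * s)" if "0 \<le> s" "s \<le> R" for s
    using close[OF that] by simp
  then show "A r = B r" using r by simp
  have "\<bar>v r - w r\<bar> \<le> 0 * exp (L * r) / \<kappa>"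
    using mean_solution_bound[OF mean_solution_diff[OF mean], of L r 0] close r L \<open>\<kappa> \<ge> 1\<close> by simp
  then show "v r = w r" by simp
qed

text \<open>Banach's fixed point theorem is applied to the map sending A to the integral of G along
  the weighted mean of A.\<close>

lemma singular_ivp_exists:
  assumes K: "\<And>r v A w B. 0 \<le> r \<Longrightarrow> r \<le> R \<Longrightarrow> \<bar>G r v A - G r w B\<bar> \<le> K * (\<bar>v - w\<bar> + \<bar>A - B\<bar>)"
    and "K \<ge> 0" "\<kappa> > 1" "R \<ge> 0"
    and G: "\<And>v A. continuous_on {0..R} v \<Longrightarrow> continuous_on {0..R} A \<Longrightarrow> continuous_on {0..R} (\<lambda>r. G r (v r) (A r))"
  shows "\<exists>v A. singular_ivp \<kappa> b R G v A"
proof -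
  define L where "L = 4 * K + 1"
  have L: "L > 0" "4 * K \<le> L" using \<open>K \<ge> 0\<close> by (auto simp: L_def)
  \<comment> \<open>The unknown of the fixed point problem is u = exp (- L s) A, so the plain sup
    distance of bounded continuous functions is the weighted distance for A.\<close>
  define A where "A u s = exp (L * s) * apply_bcontfun u s" for u s
  have contA: "continuous_on S (A u)" for u S
    unfolding A_def by (intro continuous_intros continuous_on_apply_bcontfun)
  define v where "v u = (SOME v. mean_solution \<kappa> R (A u) v)" for u
  have v: "mean_solution \<kappa> R (A u) (v u)" for u
    unfolding v_def using mean_solution_exists[OF contA \<open>\<kappa> > 1\<close>] by (rule someI_ex)
  define F where "F u r = \<kappa> * b + integral {0..r} (\<lambda>s. G s (v u s) (A u s))" for u r
  have contG: "continuous_on {0..R} (\<lambda>s. G s (v u s) (A u s))" for u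
    using v[of u] by (intro G contA) (simp add: mean_solution_def)
  have contF: "continuous_on {0..R} (F u)" for u
    unfolding F_def
    by (intro continuous_intros indefinite_integral_continuous_1 integrable_continuous_interval contG)
  have F': "(F u has_real_derivative G r (v u r) (A u r)) (at r)" if "0 < r" "r < R" for u r
    unfolding F_def using integral_has_real_derivative_interior[OF contG that]
    by (auto intro!: derivative_eq_intros)
  \<comment> \<open>Clamping freezes the argument at the ends of [0, R], which extends the image to
    a bounded continuous function on the whole line. The fixed point equation is read off on [0, R]
    only.\<close>
  define T where "T u = Bcontfun (\<lambda>x. exp (- L * clamp 0 R x) * F u (clamp 0 R x))" for u
  have T: "apply_bcontfun (T u) x = exp (- L * clamp 0 R x) * F u (clamp 0 R x)" for u x
  proof -
    have c: "continuous_on (cbox 0 R) (\<lambda>x. exp (- L * x) * F u x)"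
      using contF by (auto intro!: continuous_intros)
    have "(\<lambda>x. exp (- L * clamp 0 R x) * F u (clamp 0 R x)) \<in> bcontfun"
      unfolding bcontfun_def
      using clamp_continuous_on[OF c] clamp_bounded[OF compact_imp_bounded[OF compact_continuous_image[OF c compact_cbox]]]
      by auto
    then show ?thesis by (simp add: T_def Bcontfun_inverse)
  qed
  have lip: "dist (T u) (T u') \<le> 1 / 2 * dist u u'" for u u'
  proof (rule dist_bound)
    fix x
    define r where "r = clamp 0 R x"
    have r: "0 \<le> r" "r \<le> R" using clamp_in_interval[of 0 R x] \<open>R \<ge> 0\<close> by (auto simp: r_def)
    have close: "\<bar>A u s - A u' s\<bar> \<le> dist u u' * exp (L * s)" for s
    proof -
      have "\<bar>A u s - A u' s\<bar> = exp (L * s) * dist (apply_bcontfun u s) (apply_bcontfun u' s)"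
        by (simp add: A_def dist_real_def abs_mult flip: right_diff_distrib)
      then show ?thesis using dist_bounded[of u s u'] by (simp add: mult.commute)
    qed
    have "\<bar>F u r - F u' r\<bar> \<le> dist u u' / 2 * exp (L * r)"
      using r \<open>\<kappa> > 1\<close>
      by (intro volterra_contraction[OF K \<open>K \<ge> 0\<close> _ L v[of u] v[of u'] close contF F' contF F']) (auto simp: F_def)
    then have "exp (- L * r) * \<bar>F u r - F u' r\<bar> \<le> 1 / 2 * dist u u'"
      by (simp add: exp_minus field_simps)
    then show "dist (apply_bcontfun (T u) x) (apply_bcontfun (T u') x) \<le> 1 / 2 * dist u u'"
      by (simp add: T dist_real_def abs_mult flip: right_diff_distrib r_def)
  qed
  obtain u where u: "T u = u"
    using banach_fix_type[of "1/2" T] lip by auto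
  have AF: "A u r = F u r" if "r \<in> {0..R}" for r
  proof -
    have "apply_bcontfun u r = exp (- L * r) * F u r"
      using T[of u r] that by (simp add: u)
    then show ?thesis by (simp add: A_def exp_minus)
  qed
  have "(A u has_real_derivative G r (v u r) (A u r)) (at r)" if "0 < r" "r < R" for r
    by (rule has_field_derivative_transform_within_open[OF F'[OF that], of "{0<..<R}"]) (use that AF in auto)
  moreover have "A u 0 = \<kappa> * b" using AF[of 0] \<open>R \<ge> 0\<close> by (simp add: F_def)
  ultimately have "singular_ivp \<kappa> b R G (v u) (A u)"
    using contA v by (auto simp: singular_ivp_def)
  then show ?thesis by blast
qed

section \<open>A priori bounds\<close>

text \<open>After the last point of [a, b] where f is at least c, the sign condition makes f
  nondecreasing, so f cannot end below c.\<close>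

lemma barrier_lower:
  fixes f :: "real \<Rightarrow> real"
  assumes "a \<le> b" "continuous_on {a..b} f" "c \<le> f a"
    and f': "\<And>x. a < x \<Longrightarrow> x < b \<Longrightarrow> (f has_real_derivative f' x) (at x)"
    and nonneg: "\<And>x. a < x \<Longrightarrow> x < b \<Longrightarrow> f x < c \<Longrightarrow> 0 \<le> f' x"
  shows "c \<le> f b"
proof (rule ccontr)
  assume neg: "\<not> c \<le> f b"
  define X where "X = {x \<in> {a..b}. c \<le> f x}"
  have "X = {a..b} \<inter> f -` {c..}" by (auto simp: X_def)
  then have "closed X" by (simp add: continuous_closed_preimage assms)
  then have "compact X" unfolding compact_eq_bounded_closed X_def
    by (auto intro: bounded_subset[OF bounded_closed_interval[of a b]])
  moreover have "a \<in> X" using assms by (simp add: X_def)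
  ultimately obtain s where s: "s \<in> X" "\<And>x. x \<in> X \<Longrightarrow> x \<le> s"
    using compact_attains_sup[of X] by blast
  have "f s \<le> f b"
  proof (rule DERIV_nonneg_imp_increasing_open[where f = f])
    show "s \<le> b" "continuous_on {s..b} f"
      using s(1) assms(2) by (auto simp: X_def elim: continuous_on_subset)
    fix x assume x: "s < x" "x < b"
    then have "f x < c" "a < x" using s(2)[of x] s(1) by (auto simp: X_def not_le[symmetric])
    then show "\<exists>y. (f has_real_derivative y) (at x) \<and> 0 \<le> y"
      using f' nonneg x by blast
  qed
  then show False using neg s(1) by (simp add: X_def)
qed

lemma gronwall:
  fixes S :: "real \<Rightarrow> real"
  assumes "a \<le> b" "continuous_on {a..b} S"
    and "\<And>x. a < x \<Longrightarrow> x < b \<Longrightarrow> (S has_real_derivative S' x) (at x)"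
    and "\<And>x. a < x \<Longrightarrow> x < b \<Longrightarrow> S' x \<le> C * S x"
  shows "S b \<le> S a * exp (C * (b - a))"
proof -
  have "exp (- C * b) * S b \<le> exp (- C * a) * S a"
  proof (rule DERIV_nonpos_imp_decreasing_open[where f = "\<lambda>x. exp (- C * x) * S x", OF assms(1)])
    show "continuous_on {a..b} (\<lambda>x. exp (- C * x) * S x)" by (intro continuous_intros assms)
    fix x assume x: "a < x" "x < b"
    have "((\<lambda>x. exp (- C * x) * S x) has_real_derivative exp (- C * x) * (S' x - C * S x)) (at x)"
      by (auto intro!: derivative_eq_intros assms(3)[OF x] simp: algebra_simps)
    moreover have "exp (- C * x) * (S' x - C * S x) \<le> 0"
      using assms(4)[OF x] by (simp add: mult_le_0_iff)
    ultimately show "\<exists>y. ((\<lambda>x. exp (- C * x) * S x) has_real_derivative y) (at x) \<and> y \<le> 0" by blast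
  qed
  then have "exp (C * b) * (exp (- C * b) * S b) \<le> exp (C * b) * (exp (- C * a) * S a)"
    by (intro mult_left_mono) auto
  then show ?thesis by (simp add: exp_minus exp_diff right_diff_distrib field_simps)
qed

definition sqrt_profile_ode :: "real \<Rightarrow> real \<Rightarrow> real \<Rightarrow> real \<Rightarrow> (real \<Rightarrow> real) \<Rightarrow> (real \<Rightarrow> real) \<Rightarrow> bool" where
  "sqrt_profile_ode m lam a b w x \<longleftrightarrow> continuous_on {a..b} w \<and> continuous_on {a..b} x \<and>
     (\<forall>r\<in>{a..b}. 0 < w r) \<and>
     (\<forall>r\<in>{a<..<b}. (w has_real_derivative x r) (at r) \<and>
        (x has_real_derivative
           m * (w r - 1 / w r) / (4 * r\<^sup>2) - (lam / 2 + m / (2 * r)) * x r / (w r)\<^sup>2) (at r))"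

text \<open>In the Lienard variable \<open>q = x - (lam/2 + m/(2r))/w\<close> the equation becomes
  \<open>q' = m (w + 1/w)/(4r\<^sup>2) \<ge> 0\<close>. Hence \<open>w' \<ge> q d + (lam/2 + m/(2r))/w\<close>, which keeps \<open>w\<close> away
  from \<open>0\<close>; after that all growth is linear.\<close>

lemma sqrt_profile_bounds:
  assumes "m > 0" "lam \<ge> 0" "0 < d" "d \<le> R" "w\<^sub>0 > 0"
  obtains N where "N > 0"
    and "\<And>T w x r. \<lbrakk>T \<le> R; sqrt_profile_ode m lam d T w x; w d = w\<^sub>0; x d = x\<^sub>0; d \<le> r; r \<le> T\<rbrakk>
      \<Longrightarrow> 1 / N < w r \<and> w r < N \<and> \<bar>x r\<bar> < N"
proof -
  define a where "a r = lam / 2 + m / (2 * r)" for r :: real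
  define q\<^sub>0 where "q\<^sub>0 = x\<^sub>0 - a d / w\<^sub>0"
  \<comment> \<open>For w < c one has a/w >= (m/(2R))/w >= |q0| + 1, hence w' = q + a/w > 0. Thus w
    cannot drop below this level.\<close>
  define c where "c = min w\<^sub>0 (m / (2 * R * (\<bar>q\<^sub>0\<bar> + 1)))"
  define k where "k = m / (4 * d\<^sup>2)"
  \<comment> \<open>This rate is chosen for the Gronwall quantity \<open>S\<close> below:
    multiplying it by w + (q - q0) + 1 yields every term that bounds S'.\<close>
  define C where "C = 1 + k + \<bar>q\<^sub>0\<bar> + a d / c + k / c"
  define U where "U = (w\<^sub>0 + 1) * exp (C * (R - d))"
  \<comment> \<open>The summands control w, |x| = |q + a/w| and 1/w. None of them depends on T, so
    the bound is uniform over all shorter existence intervals, as the continuation argument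
    requires.\<close>
  define N where "N = U + \<bar>q\<^sub>0\<bar> + a d / c + 1 / c + 1"
  have "R > 0" using assms by simp
  have ad: "a d > 0" using assms by (simp add: a_def add_nonneg_pos)
  have c: "c > 0" using assms \<open>R > 0\<close> by (auto simp: c_def intro!: divide_pos_pos mult_pos_pos)
  have k: "k > 0" using assms by (simp add: k_def)
  have C: "C > 0" unfolding C_def using ad c k by (simp add: add_pos_nonneg)
  have U: "U > 0" unfolding U_def using assms by simp
  have a_mono: "m / (2 * R) \<le> a r" "a r \<le> a d" if "d \<le> r" "r \<le> R" for r
    using that assms by (auto simp: a_def intro!: divide_left_mono add_increasing)
  have "N > 0" using U ad c by (simp add: N_def add_nonneg_pos add_pos_nonneg)
  moreover have "1 / N < w r \<and> w r < N \<and> \<bar>x r\<bar> < N"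
    if "T \<le> R" and ode: "sqrt_profile_ode m lam d T w x" and init: "w d = w\<^sub>0" "x d = x\<^sub>0"
      and r: "d \<le> r" "r \<le> T" for T w x r
  proof -
    define q where "q r = x r - a r / w r" for r
    have cont: "continuous_on {d..r} w" "continuous_on {d..r} x"
      using ode r by (auto simp: sqrt_profile_ode_def elim: continuous_on_subset)
    have w_pos: "w s > 0" if "d \<le> s" "s \<le> r" for s
      using ode that r by (auto simp: sqrt_profile_ode_def)
    have w': "(w has_real_derivative x s) (at s)" if "d < s" "s < r" for s
      using ode that r by (auto simp: sqrt_profile_ode_def)
    have x': "(x has_real_derivative m * (w s - 1 / w s) / (4 * s\<^sup>2) - a s * x s / (w s)\<^sup>2) (at s)"
      if "d < s" "s < r" for s
      using ode that r by (auto simp: sqrt_profile_ode_def a_def)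
    have contq: "continuous_on {d..r} q"
      unfolding q_def a_def using w_pos assms
      by (intro continuous_intros cont) (auto simp: less_imp_neq[symmetric])
    \<comment> \<open>The damping term a x / w^2 cancels against the derivative of 1/w, while a'
      contributes m/(2 s^2 w) and thereby flips the sign of 1/w.\<close>
    have q': "(q has_real_derivative m * (w s + 1 / w s) / (4 * s\<^sup>2)) (at s)" if s: "d < s" "s < r" for s
    proof -
      have nz: "s > 0" "w s > 0" using s w_pos[of s] assms by auto
      have "(a has_real_derivative - m / (2 * s\<^sup>2)) (at s)"
        unfolding a_def using nz by (auto intro!: derivative_eq_intros simp: power2_eq_square field_simps)
      then have "(q has_real_derivative m * (w s - 1 / w s) / (4 * s\<^sup>2) - a s * x s / (w s)\<^sup>2
          - (- m / (2 * s\<^sup>2) * w s - a s * x s) / (w s * w s)) (at s)"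
        unfolding q_def using nz by (intro derivative_intros x'[OF s] w'[OF s]) auto
      also have "m * (w s - 1 / w s) / (4 * s\<^sup>2) - a s * x s / (w s)\<^sup>2
          - (- m / (2 * s\<^sup>2) * w s - a s * x s) / (w s * w s) = m * (w s + 1 / w s) / (4 * s\<^sup>2)"
        using nz by (simp add: field_simps power2_eq_square)
      finally show ?thesis .
    qed
    have q_ge: "q\<^sub>0 \<le> q s" if s: "d \<le> s" "s \<le> r" for s
    proof -
      have "q d \<le> q s"
      proof (rule DERIV_nonneg_imp_increasing_open[OF s(1)])
        show "continuous_on {d..s} q" using contq s by (auto elim: continuous_on_subset)
        fix t assume t: "d < t" "t < s"
        have "0 \<le> m * (w t + 1 / w t) / (4 * t\<^sup>2)"
          using assms w_pos[of t] t s by (auto intro!: divide_nonneg_nonneg mult_nonneg_nonneg add_nonneg_nonneg)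
        then show "\<exists>y. (q has_real_derivative y) (at t) \<and> 0 \<le> y" using q' t s by force
      qed
      then show ?thesis by (simp add: q_def q\<^sub>0_def init)
    qed
    have w_ge: "c \<le> w s" if s: "d \<le> s" "s \<le> r" for s
    proof (rule barrier_lower[OF s(1)])
      show "continuous_on {d..s} w" using cont s by (auto elim: continuous_on_subset)
      show "c \<le> w d" by (simp add: init c_def)
      fix t assume t: "d < t" "t < s"
      then show "(w has_real_derivative x t) (at t)" using w' s by simp
      assume "w t < c"
      then have "w t * (2 * R * (\<bar>q\<^sub>0\<bar> + 1)) \<le> m"
        using \<open>R > 0\<close> by (subst pos_le_divide_eq[symmetric]) (auto simp: c_def)
      then have "w t * (\<bar>q\<^sub>0\<bar> + 1) \<le> m / (2 * R)"
        using \<open>R > 0\<close> by (subst pos_le_divide_eq) (auto simp: mult_ac)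
      also have "m / (2 * R) \<le> a t" using a_mono t s r \<open>T \<le> R\<close> by simp
      finally have "\<bar>q\<^sub>0\<bar> + 1 \<le> a t / w t" using w_pos[of t] t s by (simp add: field_simps)
      then show "0 \<le> x t" using q_ge[of t] t s by (simp add: q_def)
    qed
    have a_le: "a s / w s \<le> a d / c" if s: "d \<le> s" "s \<le> r" for s
      using a_mono[of s] w_ge[OF s] c ad s r \<open>T \<le> R\<close> by (intro frac_le) auto
    \<comment> \<open>Both w and q - q0 are nonnegative and bound each other's derivatives linearly.
      The summand 1 absorbs the constant terms into the Gronwall inequality.\<close>
    define S where "S s = w s + (q s - q\<^sub>0) + 1" for s
    have "S r \<le> S d * exp (C * (r - d))"
    proof (rule gronwall[OF r(1)])
      show "continuous_on {d..r} S" unfolding S_def by (intro continuous_intros cont contq)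
      fix s assume s: "d < s" "s < r"
      show "(S has_real_derivative x s + m * (w s + 1 / w s) / (4 * s\<^sup>2)) (at s)"
        unfolding S_def by (auto intro!: derivative_eq_intros w'[OF s] q'[OF s])
      have "m * (w s + 1 / w s) / (4 * s\<^sup>2) \<le> m * (w s + 1 / c) / (4 * d\<^sup>2)"
        using s assms w_ge[of s] w_pos[of s] c
        by (intro frac_le mult_left_mono add_left_mono divide_left_mono power_mono) auto
      also have "\<dots> = k * w s + k / c"
        by (simp add: k_def distrib_left add_divide_distrib)
      finally have 1: "m * (w s + 1 / w s) / (4 * s\<^sup>2) \<le> k * w s + k / c" .
      have 2: "x s \<le> \<bar>q\<^sub>0\<bar> + (q s - q\<^sub>0) + a d / c"
        using a_le[of s] s by (simp add: q_def)
      define y B where "y = q s - q\<^sub>0" and "B = \<bar>q\<^sub>0\<bar> + a d / c + k / c"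
      have "0 \<le> y" using q_ge[of s] s by (simp add: y_def)
      then have 3: "0 \<le> k * y" "0 \<le> B * (w s + y)" "0 \<le> w s"
        using k ad c w_pos[of s] s by (auto simp: B_def intro!: mult_nonneg_nonneg)
      have "C * S s = (w s + k * w s + k + 1 + B) + y + k * y + B * (w s + y)"
        by (simp add: C_def S_def B_def y_def algebra_simps)
      then show "x s + m * (w s + 1 / w s) / (4 * s\<^sup>2) \<le> C * S s"
        using 1 2 3 k unfolding B_def y_def by linarith
    qed
    also have "S d = w\<^sub>0 + 1" by (simp add: S_def q_def q\<^sub>0_def init)
    also have "(w\<^sub>0 + 1) * exp (C * (r - d)) \<le> U"
      unfolding U_def using assms C r \<open>T \<le> R\<close> by (intro mult_left_mono) auto
    finally have S: "w r + (q r - q\<^sub>0) + 1 \<le> U" by (simp add: S_def)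
    have pos: "a d / c > 0" "1 / c > 0" "a r / w r > 0"
      using ad c w_pos[of r] a_mono[of r] r \<open>T \<le> R\<close> \<open>R > 0\<close> \<open>m > 0\<close>
      by (auto intro!: divide_pos_pos intro: less_le_trans[of 0 "m / (2 * R)"])
    have "1 / c < N" using U pos by (simp add: N_def)
    then have "1 / N < c" using c \<open>N > 0\<close> by (simp add: field_simps)
    then have "1 / N < w r" using w_ge[of r] r by simp
    moreover have "w r < N" using S q_ge[OF r(1) order_refl] pos unfolding N_def by linarith
    moreover have "x r = q r + a r / w r" by (simp add: q_def)
    then have "\<bar>x r\<bar> < N" using S q_ge[OF r(1) order_refl] w_pos[OF r(1) order_refl] a_le[OF r(1) order_refl] pos
      unfolding N_def abs_less_iff by linarith
    ultimately show ?thesis by blast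
  qed
  ultimately show thesis by (rule that)
qed

section \<open>Clipping the nonlinearity\<close>

text \<open>With x = w' and p = 1/w this is A' after the singular terms have cancelled. It is
  polynomial in v, x and p, hence Lipschitz as soon as these three quantities are bounded and
  Lipschitz.\<close>

definition profile_rhs_poly :: "real \<Rightarrow> real \<Rightarrow> real \<Rightarrow> real \<Rightarrow> real \<Rightarrow> real" where
  "profile_rhs_poly m lam v x p = (m / 2) * x * v * (p * p + p) - (m / 4) * v * v * p - (lam / 2) * x * p * p"

definition profile_rhs :: "real \<Rightarrow> real \<Rightarrow> real \<Rightarrow> real \<Rightarrow> real \<Rightarrow> real" where
  "profile_rhs m lam r v A = profile_rhs_poly m lam v (A - m / 2 * v) (1 / (1 + r * v))"

definition clip :: "real \<Rightarrow> real \<Rightarrow> real" where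
  "clip N x = max (- N) (min N x)"

text \<open>The quantities v and x are clipped directly, and the floor 1/N under w bounds the
  reciprocal by N.\<close>

definition clipped_rhs :: "real \<Rightarrow> real \<Rightarrow> real \<Rightarrow> real \<Rightarrow> real \<Rightarrow> real \<Rightarrow> real" where
  "clipped_rhs m lam N r v A =
     profile_rhs_poly m lam (clip N v) (clip N (A - m / 2 * v)) (1 / max (1 / N) (1 + r * clip N v))"

text \<open>The three clipping conditions are collected in one continuous function: where it is
  nonnegative the clipping is inactive, and its first zero is the first contact with the clipping
  level.\<close>

definition margin :: "real \<Rightarrow> real \<Rightarrow> (real \<Rightarrow> real) \<Rightarrow> (real \<Rightarrow> real) \<Rightarrow> real \<Rightarrow> real" where
  "margin m N v A r = min (min (N - \<bar>v r\<bar>) (N - \<bar>A r - m / 2 * v r\<bar>)) (1 + r * v r - 1 / N)"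

lemma clipped_rhs_eq:
  "0 \<le> margin m N v A r \<Longrightarrow> clipped_rhs m lam N r (v r) (A r) = profile_rhs m lam r (v r) (A r)"
proof -
  assume "0 \<le> margin m N v A r"
  then have bnd: "\<bar>v r\<bar> \<le> N" "\<bar>A r - m / 2 * v r\<bar> \<le> N" "1 / N \<le> 1 + r * v r"
    by (auto simp: margin_def)
  have "clip N x = x" if "\<bar>x\<bar> \<le> N" for x
    using that by (auto simp: clip_def)
  then show ?thesis
    using bnd by (simp add: clipped_rhs_def profile_rhs_def max_def)
qed

lemma continuous_on_margin:
  "continuous_on S v \<Longrightarrow> continuous_on S A \<Longrightarrow> continuous_on S (margin m N v A)"
  unfolding margin_def by (intro continuous_intros)

lemma continuous_on_clipped_rhs:
  assumes "continuous_on S v" "continuous_on S A" "N > 0"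
  shows "continuous_on S (\<lambda>r. clipped_rhs m lam N r (v r) (A r))"
proof -
  have "max (1 / N) w \<noteq> 0" for w using \<open>N > 0\<close> by (simp add: max_def) (metis less_eq_real_def not_less zero_less_divide_1_iff)
  then show ?thesis
    unfolding clipped_rhs_def profile_rhs_poly_def clip_def by (intro continuous_intros assms) auto
qed

text \<open>Boundedness is included because a product of Lipschitz functions needs it to be
  Lipschitz again. Both constants are uniform in r on [0, R].\<close>

definition bounded_lipschitz :: "real \<Rightarrow> (real \<Rightarrow> real \<Rightarrow> real \<Rightarrow> real) \<Rightarrow> bool" where
  "bounded_lipschitz R f \<longleftrightarrow> (\<exists>B\<ge>0. \<exists>K\<ge>0. \<forall>r v A w C. 0 \<le> r \<longrightarrow> r \<le> R \<longrightarrow>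
     \<bar>f r v A\<bar> \<le> B \<and> \<bar>f r v A - f r w C\<bar> \<le> K * (\<bar>v - w\<bar> + \<bar>A - C\<bar>))"

lemma bounded_lipschitzI:
  assumes "B \<ge> 0" "K \<ge> 0"
    and "\<And>r v A. 0 \<le> r \<Longrightarrow> r \<le> R \<Longrightarrow> \<bar>f r v A\<bar> \<le> B"
    and "\<And>r v A w C. 0 \<le> r \<Longrightarrow> r \<le> R \<Longrightarrow> \<bar>f r v A - f r w C\<bar> \<le> K * (\<bar>v - w\<bar> + \<bar>A - C\<bar>)"
  shows "bounded_lipschitz R f"
  using assms unfolding bounded_lipschitz_def by blast

lemma bounded_lipschitzE:
  assumes "bounded_lipschitz R f"
  obtains B K where "B \<ge> 0" "K \<ge> 0"
    "\<And>r v A. 0 \<le> r \<Longrightarrow> r \<le> R \<Longrightarrow> \<bar>f r v A\<bar> \<le> B"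
    "\<And>r v A w C. 0 \<le> r \<Longrightarrow> r \<le> R \<Longrightarrow> \<bar>f r v A - f r w C\<bar> \<le> K * (\<bar>v - w\<bar> + \<bar>A - C\<bar>)"
  using assms unfolding bounded_lipschitz_def by metis

lemma bounded_lipschitz_const: "bounded_lipschitz R (\<lambda>r v A. c)"
  by (rule bounded_lipschitzI[of "\<bar>c\<bar>" 0]) auto

lemma bounded_lipschitz_add:
  assumes "bounded_lipschitz R f" "bounded_lipschitz R g"
  shows "bounded_lipschitz R (\<lambda>r v A. f r v A + g r v A)"
proof -
  obtain B K where 1: "B \<ge> 0" "K \<ge> 0" "\<And>r v A. 0 \<le> r \<Longrightarrow> r \<le> R \<Longrightarrow> \<bar>f r v A\<bar> \<le> B"
    "\<And>r v A w C. 0 \<le> r \<Longrightarrow> r \<le> R \<Longrightarrow> \<bar>f r v A - f r w C\<bar> \<le> K * (\<bar>v - w\<bar> + \<bar>A - C\<bar>)"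
    using bounded_lipschitzE[OF assms(1)] by blast
  obtain B' K' where 2: "B' \<ge> 0" "K' \<ge> 0" "\<And>r v A. 0 \<le> r \<Longrightarrow> r \<le> R \<Longrightarrow> \<bar>g r v A\<bar> \<le> B'"
    "\<And>r v A w C. 0 \<le> r \<Longrightarrow> r \<le> R \<Longrightarrow> \<bar>g r v A - g r w C\<bar> \<le> K' * (\<bar>v - w\<bar> + \<bar>A - C\<bar>)"
    using bounded_lipschitzE[OF assms(2)] by blast
  show ?thesis
  proof (rule bounded_lipschitzI[of "B + B'" "K + K'"])
    show "\<bar>f r v A + g r v A\<bar> \<le> B + B'" if "0 \<le> r" "r \<le> R" for r v A
      using 1(3)[OF that, of v A] 2(3)[OF that, of v A] by linarith
    show "\<bar>f r v A + g r v A - (f r w C + g r w C)\<bar> \<le> (K + K') * (\<bar>v - w\<bar> + \<bar>A - C\<bar>)"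
      if "0 \<le> r" "r \<le> R" for r v A w C
      using 1(4)[OF that, of v A w C] 2(4)[OF that, of v A w C] unfolding distrib_right by linarith
  qed (use 1 2 in auto)
qed

lemma bounded_lipschitz_mult:
  assumes "bounded_lipschitz R f" "bounded_lipschitz R g"
  shows "bounded_lipschitz R (\<lambda>r v A. f r v A * g r v A)"
proof -
  obtain B K where 1: "B \<ge> 0" "K \<ge> 0" "\<And>r v A. 0 \<le> r \<Longrightarrow> r \<le> R \<Longrightarrow> \<bar>f r v A\<bar> \<le> B"
    "\<And>r v A w C. 0 \<le> r \<Longrightarrow> r \<le> R \<Longrightarrow> \<bar>f r v A - f r w C\<bar> \<le> K * (\<bar>v - w\<bar> + \<bar>A - C\<bar>)"
    using bounded_lipschitzE[OF assms(1)] by blast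
  obtain B' K' where 2: "B' \<ge> 0" "K' \<ge> 0" "\<And>r v A. 0 \<le> r \<Longrightarrow> r \<le> R \<Longrightarrow> \<bar>g r v A\<bar> \<le> B'"
    "\<And>r v A w C. 0 \<le> r \<Longrightarrow> r \<le> R \<Longrightarrow> \<bar>g r v A - g r w C\<bar> \<le> K' * (\<bar>v - w\<bar> + \<bar>A - C\<bar>)"
    using bounded_lipschitzE[OF assms(2)] by blast
  show ?thesis
  proof (rule bounded_lipschitzI[of "B * B'" "B * K' + K * B'"])
    show "\<bar>f r v A * g r v A\<bar> \<le> B * B'" if "0 \<le> r" "r \<le> R" for r v A
      unfolding abs_mult using 1(1) 1(3)[OF that] 2(3)[OF that] by (intro mult_mono) auto
    fix r v A w C :: real assume r: "0 \<le> r" "r \<le> R"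
    define D where "D = \<bar>v - w\<bar> + \<bar>A - C\<bar>"
    have "f r v A * g r v A - f r w C * g r w C =
        f r v A * (g r v A - g r w C) + (f r v A - f r w C) * g r w C"
      by (simp add: algebra_simps)
    also have "\<bar>\<dots>\<bar> \<le> \<bar>f r v A\<bar> * \<bar>g r v A - g r w C\<bar> + \<bar>f r v A - f r w C\<bar> * \<bar>g r w C\<bar>"
      unfolding abs_mult[symmetric] by (rule abs_triangle_ineq)
    also have "\<dots> \<le> B * (K' * D) + (K * D) * B'"
      unfolding D_def using 1 2 1(3,4)[OF r] 2(3,4)[OF r] by (intro add_mono mult_mono) auto
    also have "\<dots> = (B * K' + K * B') * D" by (simp add: algebra_simps)
    finally show "\<bar>f r v A * g r v A - f r w C * g r w C\<bar> \<le> (B * K' + K * B') * D" .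
  qed (use 1 2 in auto)
qed

lemma abs_clip_diff_le: "\<bar>clip N x - clip N y\<bar> \<le> \<bar>x - y\<bar>"
  by (auto simp: clip_def min_def max_def)

text \<open>Clipping is 1-Lipschitz. For the reciprocal, denominators M, M' >= 1/N give |1/M - 1/M'|
  <= N^2 |M - M'|, and r <= R bounds the factor multiplying the clipped v.\<close>

lemma bounded_lipschitz_clip:
  assumes "N > 0"
  shows "bounded_lipschitz R (\<lambda>r v A. clip N v)"
    and "bounded_lipschitz R (\<lambda>r v A. clip N (A - c * v))"
    and "bounded_lipschitz R (\<lambda>r v A. 1 / max (1 / N) (1 + r * clip N v))"
proof -
  have clip: "\<bar>clip N x\<bar> \<le> N" for x using assms by (auto simp: clip_def)
  show "bounded_lipschitz R (\<lambda>r v A. clip N v)"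
    using assms clip by (intro bounded_lipschitzI[of N 1]) (auto intro: order_trans[OF abs_clip_diff_le])
  show "bounded_lipschitz R (\<lambda>r v A. clip N (A - c * v))"
  proof (rule bounded_lipschitzI[of N "1 + \<bar>c\<bar>"])
    fix r v A w C :: real
    have "\<bar>clip N (A - c * v) - clip N (C - c * w)\<bar> \<le> \<bar>(A - C) - c * (v - w)\<bar>"
      using abs_clip_diff_le[of N "A - c * v" "C - c * w"] by (simp add: algebra_simps)
    also have "\<dots> \<le> \<bar>A - C\<bar> + \<bar>c\<bar> * \<bar>v - w\<bar>"
      unfolding abs_mult[symmetric] by (rule abs_triangle_ineq4)
    also have "\<dots> \<le> (1 + \<bar>c\<bar>) * (\<bar>v - w\<bar> + \<bar>A - C\<bar>)"
      by (simp add: algebra_simps)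
    finally show "\<bar>clip N (A - c * v) - clip N (C - c * w)\<bar> \<le> (1 + \<bar>c\<bar>) * (\<bar>v - w\<bar> + \<bar>A - C\<bar>)" .
  qed (use assms clip in auto)
  show "bounded_lipschitz R (\<lambda>r v A. 1 / max (1 / N) (1 + r * clip N v))"
  proof (rule bounded_lipschitzI[of N "N * N * \<bar>R\<bar>"])
    define M where "M r v = max (1 / N) (1 + r * clip N v)" for r v
    have M: "1 / N \<le> M r v" "M r v > 0" for r v
      using assms by (auto simp: M_def less_max_iff_disj)
    have inv: "1 / M r v \<le> N" for r v
      using M[of r v] assms by (simp add: field_simps)
    show "\<bar>1 / max (1 / N) (1 + r * clip N v)\<bar> \<le> N" for r v
      using inv[of r v] M[of r v] by (simp add: M_def)
    fix r v A w C :: real assume r: "0 \<le> r" "r \<le> R"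
    have "\<bar>M r v - M r w\<bar> \<le> \<bar>r * clip N v - r * clip N w\<bar>"
      by (auto simp: M_def max_def)
    also have "\<dots> = r * \<bar>clip N v - clip N w\<bar>"
      using r by (simp add: abs_mult flip: right_diff_distrib)
    also have "\<dots> \<le> \<bar>R\<bar> * (\<bar>v - w\<bar> + \<bar>A - C\<bar>)"
      using r abs_clip_diff_le[of N v w] by (intro mult_mono) auto
    finally have D: "\<bar>M r v - M r w\<bar> \<le> \<bar>R\<bar> * (\<bar>v - w\<bar> + \<bar>A - C\<bar>)" .
    have "1 / M r v - 1 / M r w = (1 / M r v) * (1 / M r w) * (M r w - M r v)"
      using M(2)[of r v] M(2)[of r w] by (simp add: field_simps)
    then have "\<bar>1 / M r v - 1 / M r w\<bar> = (1 / M r v) * (1 / M r w) * \<bar>M r v - M r w\<bar>"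
      using M(2)[of r v] M(2)[of r w] by (simp add: abs_mult abs_minus_commute)
    also have "\<dots> \<le> N * N * (\<bar>R\<bar> * (\<bar>v - w\<bar> + \<bar>A - C\<bar>))"
      using D inv[of r v] inv[of r w] M(2)[of r v] M(2)[of r w] assms by (intro mult_mono) auto
    finally show "\<bar>1 / max (1 / N) (1 + r * clip N v) - 1 / max (1 / N) (1 + r * clip N w)\<bar>
        \<le> N * N * \<bar>R\<bar> * (\<bar>v - w\<bar> + \<bar>A - C\<bar>)"
      by (simp add: M_def mult_ac)
  qed (use assms in auto)
qed

lemma bounded_lipschitz_clipped_rhs:
  assumes "N > 0"
  shows "bounded_lipschitz R (clipped_rhs m lam N)"
proof -
  \<comment> \<open>Subtractions are written as sums with negative constant coefficients, so closure
    under constants, sums and products suffices.\<close>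
  have "clipped_rhs m lam N = (\<lambda>r v A. let V = clip N v; X = clip N (A - m / 2 * v);
      p = 1 / max (1 / N) (1 + r * clip N v) in
      (m / 2) * X * V * (p * p + p) + (- m / 4) * V * V * p + (- lam / 2) * X * p * p)"
    by (auto simp: clipped_rhs_def profile_rhs_poly_def fun_eq_iff Let_def)
  then show ?thesis
    unfolding Let_def
    by (simp only:) (intro bounded_lipschitz_add bounded_lipschitz_mult bounded_lipschitz_const
        bounded_lipschitz_clip assms)
qed

section \<open>Well-posedness of the clipped problem\<close>

lemma clipped_ivp_unique:
  assumes "N > 0" "m \<ge> 0"
    and sol: "singular_ivp (1 + m / 2) b R (clipped_rhs m lam N) v A"
      "singular_ivp (1 + m / 2) b R (clipped_rhs m lam N) w B"
    and r: "0 \<le> r" "r \<le> R"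
  shows "v r = w r" "A r = B r"
proof -
  obtain D K where K: "D \<ge> 0" "K \<ge> 0" "\<And>r v A. 0 \<le> r \<Longrightarrow> r \<le> R \<Longrightarrow> \<bar>clipped_rhs m lam N r v A\<bar> \<le> D"
    "\<And>r v A w C. 0 \<le> r \<Longrightarrow> r \<le> R \<Longrightarrow>
      \<bar>clipped_rhs m lam N r v A - clipped_rhs m lam N r w C\<bar> \<le> K * (\<bar>v - w\<bar> + \<bar>A - C\<bar>)"
    using bounded_lipschitzE[OF bounded_lipschitz_clipped_rhs[OF assms(1), of R m lam]] by blast
  have "1 + m / 2 \<ge> 1" using assms(2) by simp
  then show "v r = w r" "A r = B r"
    using singular_ivp_unique[OF K(4) K(2) _ sol r] by auto
qed

lemma clipped_ivp_exists:
  assumes "N > 0" "m > 0" "R \<ge> 0"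
  shows "\<exists>v A. singular_ivp (1 + m / 2) b R (clipped_rhs m lam N) v A"
proof -
  obtain D K where K: "D \<ge> 0" "K \<ge> 0" "\<And>r v A. 0 \<le> r \<Longrightarrow> r \<le> R \<Longrightarrow> \<bar>clipped_rhs m lam N r v A\<bar> \<le> D"
    "\<And>r v A w C. 0 \<le> r \<Longrightarrow> r \<le> R \<Longrightarrow>
      \<bar>clipped_rhs m lam N r v A - clipped_rhs m lam N r w C\<bar> \<le> K * (\<bar>v - w\<bar> + \<bar>A - C\<bar>)"
    using bounded_lipschitzE[OF bounded_lipschitz_clipped_rhs[OF assms(1), of R m lam]] by blast
  have "1 + m / 2 > 1" using assms(2) by simp
  then show ?thesis
    using singular_ivp_exists[OF K(4) K(2) _ assms(3) continuous_on_clipped_rhs[OF _ _ assms(1)]]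
    by blast
qed

section \<open>Solutions on the half line\<close>

text \<open>Positivity of w = 1 + r v, also at the endpoints, keeps the reciprocal in
  \<open>profile_rhs\<close> away from the convention 1/0 = 0 and is what permits taking h =
  w^2.\<close>

definition profile_ivp ::
  "real \<Rightarrow> real \<Rightarrow> real \<Rightarrow> real \<Rightarrow> (real \<Rightarrow> real) \<Rightarrow> (real \<Rightarrow> real) \<Rightarrow> bool" where
  "profile_ivp m lam b R v A \<longleftrightarrow> singular_ivp (1 + m / 2) b R (profile_rhs m lam) v A \<and>
     (\<forall>r\<in>{0..R}. 0 < 1 + r * v r)"

lemma profile_ivp_restrict:
  "profile_ivp m lam b R v A \<Longrightarrow> S \<le> R \<Longrightarrow> profile_ivp m lam b S v A"
  by (auto simp: profile_ivp_def intro: singular_ivp_restrict)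

lemma profile_ivp_continuous_on:
  assumes "profile_ivp m lam b R v A"
  shows "continuous_on {0..R} v" "continuous_on {0..R} A"
  using assms by (auto simp: profile_ivp_def singular_ivp_def mean_solution_def)

text \<open>By compactness v, x and 1/w are bounded on [0, R]. The claim covers all larger levels N,
  so that one level can be shared by two solutions.\<close>

lemma profile_ivp_margin:
  assumes "profile_ivp m lam b R v A"
  obtains N\<^sub>0 where "N\<^sub>0 > 0" "\<And>N r. N\<^sub>0 \<le> N \<Longrightarrow> 0 \<le> r \<Longrightarrow> r \<le> R \<Longrightarrow> 0 < margin m N v A r"
proof -
  note cont = profile_ivp_continuous_on[OF assms]
  have bnd: "\<exists>B. \<forall>r\<in>{0..R}. \<bar>f r\<bar> \<le> B" if "continuous_on {0..R} f" for f :: "real \<Rightarrow> real"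
    using compact_imp_bounded[OF compact_continuous_image[OF that compact_Icc]]
    by (auto simp: bounded_iff)
  obtain B\<^sub>1 where 1: "\<And>r. r \<in> {0..R} \<Longrightarrow> \<bar>v r\<bar> \<le> B\<^sub>1"
    using bnd[OF cont(1)] by blast
  have "continuous_on {0..R} (\<lambda>r. A r - m / 2 * v r)" by (intro continuous_intros cont)
  then obtain B\<^sub>2 where 2: "\<And>r. r \<in> {0..R} \<Longrightarrow> \<bar>A r - m / 2 * v r\<bar> \<le> B\<^sub>2"
    using bnd by blast
  have pos: "0 < 1 + r * v r" if "r \<in> {0..R}" for r using assms that by (auto simp: profile_ivp_def)
  have "continuous_on {0..R} (\<lambda>r. 1 / (1 + r * v r))"
    using pos by (intro continuous_intros cont) (auto simp: less_imp_neq[symmetric])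
  then obtain B\<^sub>3 where 3: "\<And>r. r \<in> {0..R} \<Longrightarrow> \<bar>1 / (1 + r * v r)\<bar> \<le> B\<^sub>3"
    using bnd by blast
  define N\<^sub>0 where "N\<^sub>0 = \<bar>B\<^sub>1\<bar> + \<bar>B\<^sub>2\<bar> + \<bar>B\<^sub>3\<bar> + 1"
  have "0 < margin m N v A r" if "N\<^sub>0 \<le> N" "0 \<le> r" "r \<le> R" for N r
  proof -
    have r: "r \<in> {0..R}" using that by simp
    have N: "\<bar>B\<^sub>1\<bar> < N" "\<bar>B\<^sub>2\<bar> < N" "\<bar>B\<^sub>3\<bar> < N" "N > 0" using that(1) by (auto simp: N\<^sub>0_def)
    have "1 / (1 + r * v r) < N" using 3[OF r] N by linarith
    then have "1 / N < 1 + r * v r" using pos[OF r] \<open>N > 0\<close> by (simp add: field_simps)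
    then show ?thesis using 1[OF r] 2[OF r] N by (simp add: margin_def)
  qed
  moreover have "N\<^sub>0 > 0" by (simp add: N\<^sub>0_def)
  ultimately show thesis using that by blast
qed

lemma profile_ivp_imp_clipped:
  assumes "profile_ivp m lam b R v A" "\<And>r. 0 \<le> r \<Longrightarrow> r \<le> R \<Longrightarrow> 0 \<le> margin m N v A r"
  shows "singular_ivp (1 + m / 2) b R (clipped_rhs m lam N) v A"
proof (rule singular_ivp_cong)
  show "singular_ivp (1 + m / 2) b R (profile_rhs m lam) v A"
    using assms(1) by (simp add: profile_ivp_def)
  show "profile_rhs m lam r (v r) (A r) = clipped_rhs m lam N r (v r) (A r)" if "0 < r" "r < R" for r
    using clipped_rhs_eq[OF assms(2)] that by simp
qed

lemma clipped_imp_profile_ivp: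
  assumes "singular_ivp (1 + m / 2) b R (clipped_rhs m lam N) v A" "N > 0"
    and margin: "\<And>r. 0 \<le> r \<Longrightarrow> r \<le> R \<Longrightarrow> 0 \<le> margin m N v A r"
  shows "profile_ivp m lam b R v A"
proof -
  have "0 < 1 + r * v r" if "r \<in> {0..R}" for r
  proof -
    have "1 / N \<le> 1 + r * v r" using margin[of r] that by (simp add: margin_def)
    then show ?thesis using \<open>N > 0\<close> by (smt (verit) zero_less_divide_1_iff)
  qed
  moreover have "singular_ivp (1 + m / 2) b R (profile_rhs m lam) v A"
  proof (rule singular_ivp_cong)
    show "singular_ivp (1 + m / 2) b R (clipped_rhs m lam N) v A" by (rule assms(1))
    show "clipped_rhs m lam N r (v r) (A r) = profile_rhs m lam r (v r) (A r)" if "0 < r" "r < R" for r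
      using clipped_rhs_eq[OF margin] that by simp
  qed
  ultimately show ?thesis by (simp add: profile_ivp_def)
qed

text \<open>At a common clipping level above the size of both solutions, both solve the same
  globally Lipschitz problem.\<close>

lemma profile_ivp_unique:
  assumes "m \<ge> 0" and sol: "profile_ivp m lam b R v A" "profile_ivp m lam b R w B"
    and "0 \<le> r" "r \<le> R"
  shows "v r = w r" "A r = B r"
proof -
  obtain N\<^sub>1 where 1: "N\<^sub>1 > 0" "\<And>N r. N\<^sub>1 \<le> N \<Longrightarrow> 0 \<le> r \<Longrightarrow> r \<le> R \<Longrightarrow> 0 < margin m N v A r"
    using profile_ivp_margin[OF sol(1)] by blast
  obtain N\<^sub>2 where 2: "N\<^sub>2 > 0" "\<And>N r. N\<^sub>2 \<le> N \<Longrightarrow> 0 \<le> r \<Longrightarrow> r \<le> R \<Longrightarrow> 0 < margin m N w B r"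
    using profile_ivp_margin[OF sol(2)] by blast
  define N where "N = max N\<^sub>1 N\<^sub>2"
  have "N > 0" using 1 by (simp add: N_def)
  moreover have "singular_ivp (1 + m / 2) b R (clipped_rhs m lam N) v A"
    "singular_ivp (1 + m / 2) b R (clipped_rhs m lam N) w B"
    using 1 2 by (auto intro!: profile_ivp_imp_clipped sol less_imp_le simp: N_def)
  ultimately show "v r = w r" "A r = B r"
    using clipped_ivp_unique[OF _ assms(1) _ _ assms(4,5)] by blast+
qed

text \<open>This is the cancellation behind the choice of A: since A = x + (m/2) v and v' = (x -
  v)/r, the left side is x' computed from A', and the right side is the singular equation for
  w.\<close>

lemma profile_rhs_poly_eq:
  assumes "r > 0" "w > 0"
  shows "profile_rhs_poly m lam ((w - 1) / r) x (1 / w) - m / 2 * ((x - (w - 1) / r) / r) =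
    m * (w - 1 / w) / (4 * r\<^sup>2) - (lam / 2 + m / (2 * r)) * x / w\<^sup>2"
proof -
  define p q where "p = 1 / w" and "q = 1 / r"
  define V where "V = (w - 1) * q"
  have "w * p = 1" using assms by (simp add: p_def)
  \<comment> \<open>The relation w p = 1 trades the product V p for q (1 - p), which turns the
    regular polynomial back into terms with explicit powers of 1/r.\<close>
  then have Vp: "V * p = q * (1 - p)" and VV: "V * (1 - p) = q * (w - 2 + p)"
    unfolding V_def by algebra+
  have "profile_rhs_poly m lam V x p - m / 2 * ((x - V) * q) =
      (m / 2) * x * (V * p) * (p + 1) - (m / 4) * (V * (V * p)) - (lam / 2) * x * p * p - m / 2 * ((x - V) * q)"
    by (simp add: profile_rhs_poly_def algebra_simps)
  also have "V * (V * p) = q * q * (w - 2 + p)" unfolding Vp using VV by algebra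
  also have "(m / 2) * x * (V * p) * (p + 1) - (m / 4) * (q * q * (w - 2 + p)) - (lam / 2) * x * p * p
      - m / 2 * ((x - V) * q) = m * (w - p) / 4 * (q * q) - (lam / 2 + m / 2 * q) * x * (p * p)"
    unfolding Vp unfolding V_def by (simp add: field_simps)
  finally show ?thesis by (simp add: p_def q_def V_def power2_eq_square)
qed

text \<open>The product rule gives w' = v + r v' = A - (m/2) v = x, and x' = A' - (m/2) v' is
  evaluated by the preceding identity.\<close>

lemma singular_ivp_imp_ode:
  assumes "singular_ivp (1 + m / 2) b R (profile_rhs m lam) v A" "0 < r" "r < R" "0 < 1 + r * v r"
  defines "w \<equiv> (\<lambda>r. 1 + r * v r)" and "x \<equiv> (\<lambda>r. A r - m / 2 * v r)"
  shows "(w has_real_derivative x r) (at r)"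
    and "(x has_real_derivative
           m * (w r - 1 / w r) / (4 * r\<^sup>2) - (lam / 2 + m / (2 * r)) * x r / (w r)\<^sup>2) (at r)"
proof -
  have v': "(v has_real_derivative (A r - (1 + m / 2) * v r) / r) (at r)"
    and A': "(A has_real_derivative profile_rhs m lam r (v r) (A r)) (at r)"
    using assms by (auto simp: singular_ivp_def mean_solution_def)
  show "(w has_real_derivative x r) (at r)"
    unfolding w_def x_def using \<open>0 < r\<close>
    by (auto intro!: derivative_eq_intros v' simp: field_simps)
  have v: "v r = (w r - 1) / r" and w: "w r > 0" and A: "A r = x r + m / 2 * v r"
    using assms by (auto simp: w_def x_def)
  have "profile_rhs m lam r (v r) (A r) - m / 2 * ((A r - (1 + m / 2) * v r) / r) =
      profile_rhs_poly m lam (v r) (x r) (1 / w r) - m / 2 * ((x r - v r) / r)"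
    by (simp add: profile_rhs_def w_def x_def algebra_simps)
  also have "\<dots> = m * (w r - 1 / w r) / (4 * r\<^sup>2) - (lam / 2 + m / (2 * r)) * x r / (w r)\<^sup>2"
    unfolding v by (rule profile_rhs_poly_eq[OF \<open>0 < r\<close> w])
  finally show "(x has_real_derivative
      m * (w r - 1 / w r) / (4 * r\<^sup>2) - (lam / 2 + m / (2 * r)) * x r / (w r)\<^sup>2) (at r)"
    unfolding x_def by (intro DERIV_cong[OF DERIV_diff[OF A' DERIV_cmult[OF v']]]) (simp add: x_def)
qed

lemma profile_ivp_imp_sqrt_profile_ode:
  assumes "profile_ivp m lam b R v A" "0 < d"
  shows "sqrt_profile_ode m lam d R (\<lambda>r. 1 + r * v r) (\<lambda>r. A r - m / 2 * v r)"
proof -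
  have "continuous_on {d..R} v" "continuous_on {d..R} A"
    using profile_ivp_continuous_on[OF assms(1)] assms(2) by (auto elim!: continuous_on_subset)
  moreover have "0 < 1 + r * v r" if "r \<in> {d..R}" for r
    using assms that by (auto simp: profile_ivp_def)
  moreover have "((\<lambda>r. 1 + r * v r) has_real_derivative A r - m / 2 * v r) (at r)"
    "((\<lambda>r. A r - m / 2 * v r) has_real_derivative
       m * ((1 + r * v r) - 1 / (1 + r * v r)) / (4 * r\<^sup>2)
       - (lam / 2 + m / (2 * r)) * (A r - m / 2 * v r) / (1 + r * v r)\<^sup>2) (at r)"
    if "r \<in> {d<..<R}" for r
    using singular_ivp_imp_ode[of m b R lam v A r] assms that by (auto simp: profile_ivp_def)
  ultimately show ?thesis
    unfolding sqrt_profile_ode_def by (intro conjI ballI continuous_intros) auto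
qed

text \<open>At the origin v = x = b and w = 1, so the level |b| + 2 leaves a positive margin there;
  by continuity the clipping stays inactive on a short interval.\<close>

lemma profile_ivp_local:
  assumes "m > 0"
  obtains d v A where "d > 0" "profile_ivp m lam b d v A"
proof -
  define N where "N = \<bar>b\<bar> + 2"
  have "N > 0" by (simp add: N_def)
  then obtain v A where sol: "singular_ivp (1 + m / 2) b 1 (clipped_rhs m lam N) v A"
    using clipped_ivp_exists[of N m 1 b lam] assms by auto
  have A0: "A 0 = (1 + m / 2) * b" and "v 0 = A 0 / (1 + m / 2)"
    using sol by (auto simp: singular_ivp_def mean_solution_def)
  moreover have "1 + m / 2 \<noteq> 0" using assms by simp
  ultimately have v0: "v 0 = b" by simp
  have "1 / N < 1" by (simp add: N_def)
  then have pos: "0 < margin m N v A 0"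
    unfolding margin_def A0 v0 by (simp add: algebra_simps) (simp add: N_def)
  have "continuous_on {0..1} (margin m N v A)"
    using sol by (intro continuous_on_margin) (auto simp: singular_ivp_def mean_solution_def)
  then obtain e where e: "e > 0"
    "\<And>r. r \<in> {0..1} \<Longrightarrow> dist r 0 < e \<Longrightarrow> dist (margin m N v A r) (margin m N v A 0) < margin m N v A 0"
    using pos unfolding continuous_on_iff by (metis atLeastAtMost_iff order_refl zero_le_one)
  define d where "d = min 1 (e / 2)"
  have d: "0 < d" "d \<le> 1" "d < e" using e(1) by (auto simp: d_def)
  have "0 \<le> margin m N v A r" if "0 \<le> r" "r \<le> d" for r
    using e(2)[of r] that d by (simp add: dist_real_def)
  then have "profile_ivp m lam b d v A"
    using clipped_imp_profile_ivp[OF singular_ivp_restrict[OF sol d(2)] \<open>N > 0\<close>] by blast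
  then show thesis using that d(1) by blast
qed

text \<open>A clipped solution with a large enough clipping level never reaches that level: at the first
  contact it would still solve the original equation and hence obey the a priori bounds.\<close>

lemma profile_ivp_exists:
  assumes "m > 0" "lam \<ge> 0" "R > 0"
  shows "\<exists>v A. profile_ivp m lam b R v A"
proof -
  obtain d v\<^sub>0 A\<^sub>0 where d: "d > 0" and sol0: "profile_ivp m lam b d v\<^sub>0 A\<^sub>0"
    using profile_ivp_local[OF \<open>m > 0\<close>] by blast
  show ?thesis
  proof (cases "R \<le> d")
    case True
    then show ?thesis using profile_ivp_restrict[OF sol0] by blast
  next
    case False
    have w0: "0 < 1 + d * v\<^sub>0 d" using sol0 d by (auto simp: profile_ivp_def)
    have "d \<le> R" using False by simp
    obtain N\<^sub>1 where N\<^sub>1: "N\<^sub>1 > 0"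
      "\<And>T w x r. \<lbrakk>T \<le> R; sqrt_profile_ode m lam d T w x; w d = 1 + d * v\<^sub>0 d;
         x d = A\<^sub>0 d - m / 2 * v\<^sub>0 d; d \<le> r; r \<le> T\<rbrakk> \<Longrightarrow> 1 / N\<^sub>1 < w r \<and> w r < N\<^sub>1 \<and> \<bar>x r\<bar> < N\<^sub>1"
      by (rule sqrt_profile_bounds[OF assms(1,2) d \<open>d \<le> R\<close> w0, of "A\<^sub>0 d - m / 2 * v\<^sub>0 d"])
        (rule that, assumption, blast)
    obtain N\<^sub>0 where N\<^sub>0: "N\<^sub>0 > 0" "\<And>N r. N\<^sub>0 \<le> N \<Longrightarrow> 0 \<le> r \<Longrightarrow> r \<le> d \<Longrightarrow> 0 < margin m N v\<^sub>0 A\<^sub>0 r"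
      using profile_ivp_margin[OF sol0] by blast
    \<comment> \<open>The three summands serve the interval [0, d], the a priori bounds beyond d,
      and the bound for v: there v = (w - 1)/r with r >= d, so |v| < (N1 + 1)/d.\<close>
    define N where "N = N\<^sub>0 + N\<^sub>1 + (N\<^sub>1 + 1) / d"
    have "(N\<^sub>1 + 1) / d > 0" using N\<^sub>1(1) d by simp
    then have N: "N > 0" "N\<^sub>0 \<le> N" "N\<^sub>1 \<le> N" "(N\<^sub>1 + 1) / d < N"
      using N\<^sub>0(1) N\<^sub>1(1) unfolding N_def by linarith+
    obtain v A where sol: "singular_ivp (1 + m / 2) b R (clipped_rhs m lam N) v A"
      using clipped_ivp_exists[OF N(1) assms(1), of R b lam] assms(3) by auto
    \<comment> \<open>Uniqueness for the clipped problem identifies the solution on [0, d] with the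
      local one. Its data at d were fixed before N was chosen, so the bound N1 applies without
      circularity.\<close>
    have near: "v r = v\<^sub>0 r" "A r = A\<^sub>0 r" if "0 \<le> r" "r \<le> d" for r
    proof -
      have "singular_ivp (1 + m / 2) b d (clipped_rhs m lam N) v\<^sub>0 A\<^sub>0"
        using N\<^sub>0(2)[OF N(2)] by (intro profile_ivp_imp_clipped[OF sol0]) (auto simp: less_imp_le)
      moreover have "singular_ivp (1 + m / 2) b d (clipped_rhs m lam N) v A"
        using False by (intro singular_ivp_restrict[OF sol]) auto
      ultimately show "v r = v\<^sub>0 r" "A r = A\<^sub>0 r"
        using clipped_ivp_unique[OF N(1) _ _ _ that] assms(1) by (meson less_imp_le)+
    qed
    define \<phi> where "\<phi> = margin m N v A"
    have cont\<phi>: "continuous_on {0..R} \<phi>"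
      unfolding \<phi>_def using sol by (intro continuous_on_margin) (auto simp: singular_ivp_def mean_solution_def)
    have \<phi>_near: "0 < \<phi> r" if "0 \<le> r" "r \<le> d" for r
      using N\<^sub>0(2)[OF N(2) that] near[OF that] by (simp add: \<phi>_def margin_def)
    have \<phi>_apriori: "0 < \<phi> T" if T: "d \<le> T" "T \<le> R" "\<And>r. 0 \<le> r \<Longrightarrow> r \<le> T \<Longrightarrow> 0 \<le> \<phi> r" for T
    proof -
      have "profile_ivp m lam b T v A"
        using clipped_imp_profile_ivp[OF singular_ivp_restrict[OF sol T(2)] N(1)] T(3) by (simp add: \<phi>_def)
      then have "sqrt_profile_ode m lam d T (\<lambda>r. 1 + r * v r) (\<lambda>r. A r - m / 2 * v r)"
        using d by (rule profile_ivp_imp_sqrt_profile_ode)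
      from N\<^sub>1(2)[OF T(2) this, of T] have
        *: "1 / N\<^sub>1 < 1 + T * v T" "1 + T * v T < N\<^sub>1" "\<bar>A T - m / 2 * v T\<bar> < N\<^sub>1"
        using near[of d] d T by auto
      have "1 / N\<^sub>1 > 0" using N\<^sub>1(1) by simp
      then have "\<bar>T * v T\<bar> < N\<^sub>1 + 1" using * by linarith
      then have "T * \<bar>v T\<bar> < N\<^sub>1 + 1" using d T by (simp add: abs_mult)
      moreover have "d * \<bar>v T\<bar> \<le> T * \<bar>v T\<bar>" using T by (intro mult_right_mono) auto
      ultimately have "\<bar>v T\<bar> < (N\<^sub>1 + 1) / d" using d by (simp add: pos_less_divide_eq mult.commute)
      moreover have "1 / N \<le> 1 / N\<^sub>1" using N(3) N\<^sub>1(1) by (intro divide_left_mono) auto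
      ultimately show ?thesis using * N by (simp add: \<phi>_def margin_def)
    qed
    have "0 < \<phi> r" if r: "0 \<le> r" "r \<le> R" for r
    proof (rule ccontr)
      assume "\<not> 0 < \<phi> r"
      \<comment> \<open>The least point T of this set is the first contact. The intermediate value
        theorem makes the margin exactly 0 at T, so it is nonnegative on [0, T], and the a priori
        bounds then make it positive at T.\<close>
      define X where "X = {0..R} \<inter> \<phi> -` {..0}"
      have "closed X" unfolding X_def by (intro continuous_closed_preimage cont\<phi>) auto
      then have "compact X" unfolding compact_eq_bounded_closed X_def
        by (auto intro: bounded_subset[OF bounded_closed_interval[of 0 R]])
      moreover have "r \<in> X" using r \<open>\<not> 0 < \<phi> r\<close> by (simp add: X_def)
      ultimately obtain T where T: "T \<in> X" "\<And>s. s \<in> X \<Longrightarrow> T \<le> s"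
        using compact_attains_inf[of X] by blast
      have T': "0 \<le> T" "T \<le> R" "\<phi> T \<le> 0" using T(1) by (auto simp: X_def)
      have "\<exists>s\<ge>0. s \<le> T \<and> \<phi> s = 0"
        using T' \<phi>_near[of 0] d by (intro IVT2' continuous_on_subset[OF cont\<phi>]) auto
      then obtain s where s: "0 \<le> s" "s \<le> T" "\<phi> s = 0" by blast
      then have "T \<le> s" using T(2)[of s] T' by (simp add: X_def)
      then have "\<phi> T = 0" using s by simp
      have "d \<le> T" using \<phi>_near[of T] T' by (cases "d \<le> T") auto
      moreover have "0 \<le> \<phi> s" if "0 \<le> s" "s \<le> T" for s
      proof (rule ccontr)
        assume neg: "\<not> 0 \<le> \<phi> s"
        then have "s \<in> X" using that T' by (simp add: X_def)
        then have "s = T" using T(2)[of s] that by simp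
        then show False using neg \<open>\<phi> T = 0\<close> by simp
      qed
      ultimately show False using \<phi>_apriori[of T] T' by simp
    qed
    then have "profile_ivp m lam b R v A"
      using clipped_imp_profile_ivp[OF sol N(1)] by (simp add: \<phi>_def less_imp_le)
    then show ?thesis by blast
  qed
qed

section \<open>Gluing the solutions on finite intervals\<close>

lemma profile_ivp_transform:
  assumes sol: "profile_ivp m lam b R v A" and "R \<ge> 0"
    and eq: "\<And>r. 0 \<le> r \<Longrightarrow> r \<le> R \<Longrightarrow> w r = v r" "\<And>r. 0 \<le> r \<Longrightarrow> r \<le> R \<Longrightarrow> B r = A r"
  shows "profile_ivp m lam b R w B"
proof -
  have tr: "(g has_real_derivative D) (at r)"
    if "(f has_real_derivative D) (at r)" "\<And>r. 0 \<le> r \<Longrightarrow> r \<le> R \<Longrightarrow> g r = f r" "0 < r" "r < R" for f g D r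
    by (rule has_field_derivative_transform_within_open[OF that(1), of "{0<..<R}"]) (use that in auto)
  have "continuous_on {0..R} w" "continuous_on {0..R} B"
    using profile_ivp_continuous_on[OF sol] eq by (auto intro: continuous_on_eq)
  then show ?thesis
    using sol \<open>R \<ge> 0\<close> eq tr[OF _ eq(1)] tr[OF _ eq(2)]
    by (simp add: profile_ivp_def singular_ivp_def mean_solution_def)
qed

lemma profile_ivp_global:
  assumes "m > 0" "lam \<ge> 0"
  obtains v A where "\<And>R. R > 0 \<Longrightarrow> profile_ivp m lam b R v A"
proof -
  have "\<forall>R. \<exists>v A. R > 0 \<longrightarrow> profile_ivp m lam b R v A"
    using profile_ivp_exists[OF assms] by blast
  then obtain V B where sol: "\<And>R. R > 0 \<Longrightarrow> profile_ivp m lam b R (V R) (B R)"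
    by metis
  \<comment> \<open>The value at r is taken from the solution on [0, r + 1], an interval of positive
    length even for r = 0. Uniqueness makes it agree with the solution on [0, R + 1].\<close>
  have "profile_ivp m lam b R (\<lambda>r. V (r + 1) r) (\<lambda>r. B (r + 1) r)" if "R > 0" for R
  proof (rule profile_ivp_transform[OF profile_ivp_restrict[OF sol[of "R + 1"], of R]])
    fix r assume r: "0 \<le> r" "r \<le> R"
    have "profile_ivp m lam b (r + 1) (V (R + 1)) (B (R + 1))"
      using r by (intro profile_ivp_restrict[OF sol[of "R + 1"]]) auto
    moreover have "profile_ivp m lam b (r + 1) (V (r + 1)) (B (r + 1))"
      using r by (intro sol) auto
    ultimately show "V (r + 1) r = V (R + 1) r" "B (r + 1) r = B (R + 1) r"
      using profile_ivp_unique[of m lam b "r + 1"] assms(1) r by auto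
  qed (use that in auto)
  then show thesis by (rule that)
qed

section \<open>From the profile equation to the singular problem and back\<close>

lemma Ck_on_cong:
  assumes "Ck_on k S f" "\<And>x. x \<in> S \<Longrightarrow> f x = g x"
  shows "Ck_on k S g"
  using assms
proof (induction k arbitrary: f g)
  case 0
  then show ?case by (auto intro: continuous_on_eq)
next
  case (Suc k)
  have "(f has_vector_derivative D) (at x within S) \<longleftrightarrow> (g has_vector_derivative D) (at x within S)"
    if "x \<in> S" for x D
    using has_vector_derivative_transform[OF that, of g f D] has_vector_derivative_transform[OF that, of f g D]
      Suc.prems(2) by auto
  then have "vector_derivative f (at x within S) = vector_derivative g (at x within S)" if "x \<in> S" for x
    using that by (simp add: vector_derivative_def)
  moreover have "g differentiable at x within S" if "x \<in> S" for x
  proof (rule differentiable_transform_within[of f _ _ 1])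
    show "f differentiable at x within S" using Suc.prems(1) that by (simp add: differentiable_on_def)
  qed (use Suc.prems(2) that in auto)
  then have "g differentiable_on S" by (simp add: differentiable_on_def)
  ultimately show ?case using Suc by auto
qed

text \<open>Nontriviality of the filter makes derivatives within S unique, so
  \<open>vector_derivative\<close> returns the given f' also at an endpoint.\<close>

lemma Ck_on_SucI:
  assumes "\<And>x. x \<in> S \<Longrightarrow> (f has_real_derivative f' x) (at x within S)"
    and "\<And>x. x \<in> S \<Longrightarrow> at x within S \<noteq> bot" and "Ck_on k S f'"
  shows "Ck_on (Suc k) S f"
proof -
  have vd: "f' x = vector_derivative f (at x within S)" if "x \<in> S" for x
    using assms(1)[OF that]
    by (intro vector_derivative_within[symmetric] assms(2) that)
       (simp add: has_real_derivative_iff_has_vector_derivative)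
  have "Ck_on k S (\<lambda>x. vector_derivative f (at x within S))"
    by (rule Ck_on_cong[OF assms(3) vd])
  moreover have "f differentiable_on S"
    unfolding differentiable_on_def
    using assms(1) differentiableI[OF has_field_derivative_imp_has_derivative] by fast
  ultimately show ?thesis by simp
qed

lemma Ck_on_SucD:
  assumes "Ck_on (Suc k) S f" "open S"
  shows "\<And>x. x \<in> S \<Longrightarrow> (f has_real_derivative deriv f x) (at x)" and "Ck_on k S (deriv f)"
proof -
  show der: "(f has_real_derivative deriv f x) (at x)" if "x \<in> S" for x
  proof -
    have "f differentiable (at x)"
      using assms that by (auto simp: differentiable_on_def at_within_open[OF that])
    then show ?thesis
      by (simp add: DERIV_deriv_iff_real_differentiable)
  qed
  show "Ck_on k S (deriv f)"
  proof (rule Ck_on_cong)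
    show "Ck_on k S (\<lambda>x. vector_derivative f (at x within S))" using assms by simp
    show "vector_derivative f (at x within S) = deriv f x" if "x \<in> S" for x
      using der[OF that] at_within_open[OF that assms(2)]
      by (simp add: vector_derivative_at has_real_derivative_iff_has_vector_derivative)
  qed
qed

lemma continuous_on_atLeast:
  fixes f :: "real \<Rightarrow> real"
  assumes "\<And>R. R > 0 \<Longrightarrow> continuous_on {0..R} f"
  shows "continuous_on {0..} f"
  unfolding continuous_on_eq_continuous_within
proof
  fix x :: real assume x: "x \<in> {0..}"
  have "at x within {0..} = at x within {0..x + 1}"
    by (rule at_within_nhd[of _ "{..<x + 1}"]) auto
  then show "continuous (at x within {0..}) f"
    using assms[of "x + 1"] x by (auto simp: continuous_on_eq_continuous_within)
qed

lemma at_within_half_line_neq_bot: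
  fixes x :: real
  shows "x \<in> {0..} \<Longrightarrow> at x within {0..} \<noteq> bot"
    and "x \<in> {0<..} \<Longrightarrow> at x within {0<..} \<noteq> bot"
proof -
  have *: "at x within S \<noteq> bot" if "{x<..<x + 1} \<subseteq> S" for S
    using islimpt_subset[OF islimpt_greaterThanLessThan1[of x "x + 1"] that]
    by (simp add: trivial_limit_within)
  show "x \<in> {0..} \<Longrightarrow> at x within {0..} \<noteq> bot" "x \<in> {0<..} \<Longrightarrow> at x within {0<..} \<noteq> bot"
    by (rule *; force)+
qed

text \<open>With h = w^2, h' = 2 w x and h'' = 2 (x^2 + w y), the quadratic term r^2 h'^2 cancels
  the x^2 part of the left side, which is the purpose of the square root. The two sides then differ
  by 4 r^2 w^3 times the defect in the equation for y.\<close>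

lemma profile_equation_square_iff:
  fixes m lam r w x y :: real
  assumes "r > 0" "w > 0"
  shows "2 * r^2 * w\<^sup>2 * (2 * (x * x + w * y)) =
      m * w\<^sup>2 * (w\<^sup>2 - 1) + r * (2 * (w * x)) * (r * (2 * (w * x)) - lam * r - m) \<longleftrightarrow>
    y = m * (w - 1 / w) / (4 * r\<^sup>2) - (lam / 2 + m / (2 * r)) * x / w\<^sup>2"
    (is "?L = ?R \<longleftrightarrow> y = ?Y")
proof -
  have "4 * r\<^sup>2 * w^3 * ?Y = m * w\<^sup>2 * (w\<^sup>2 - 1) - 2 * r * w * x * (lam * r + m)"
    using assms by (simp add: field_simps power2_eq_square power3_eq_cube)
  then have "?L - ?R = 4 * r\<^sup>2 * w^3 * (y - ?Y)"
    by (simp add: right_diff_distrib) (simp add: algebra_simps power2_eq_square power3_eq_cube)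
  moreover have "4 * r\<^sup>2 * w^3 \<noteq> 0" using assms by simp
  ultimately show ?thesis by (metis eq_iff_diff_eq_0 mult_eq_0_iff)
qed

text \<open>The parameter is \<mu>/2 because h' = 2 w w' and w(0) = 1. Continuity of v and x up to 0
  yields the C^1 regularity there, while the equation itself shows that w'' is continuous for r >
  0.\<close>

lemma profile_solution_of_ivp:
  assumes "of_int n - 1 = m" "m > 0" and sol: "\<And>R. R > 0 \<Longrightarrow> profile_ivp m lam (\<mu> / 2) R v A"
  shows "profile_solution lam \<mu> n (\<lambda>r. (1 + r * v r)\<^sup>2)"
proof -
  define w where "w r = 1 + r * v r" for r
  define x where "x r = A r - m / 2 * v r" for r
  define y where "y r = m * (w r - 1 / w r) / (4 * r\<^sup>2) - (lam / 2 + m / (2 * r)) * x r / (w r)\<^sup>2" for r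
  define h where "h r = (w r)\<^sup>2" for r
  have cv: "continuous_on {0..} v" and cA: "continuous_on {0..} A"
    using profile_ivp_continuous_on[OF sol] by (auto intro: continuous_on_atLeast)
  have cw: "continuous_on {0..} w" and cx: "continuous_on {0..} x"
    unfolding w_def x_def by (intro continuous_intros cv cA)+
  have pos: "w r > 0" if "r \<ge> 0" for r
    using sol[of "r + 1"] that by (auto simp: profile_ivp_def w_def)
  have A0: "A 0 = (1 + m / 2) * (\<mu> / 2)" "v 0 = A 0 / (1 + m / 2)"
    using sol[of 1] by (auto simp: profile_ivp_def singular_ivp_def mean_solution_def)
  moreover have "1 + m / 2 \<noteq> 0" using \<open>m > 0\<close> by simp
  ultimately have v0: "v 0 = \<mu> / 2" by simp
  then have x0: "x 0 = \<mu> / 2" by (simp add: x_def A0(1) algebra_simps)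
  have w': "(w has_real_derivative x r) (at r)" and x': "(x has_real_derivative y r) (at r)" if "r > 0" for r
    using singular_ivp_imp_ode[of m "\<mu> / 2" "r + 1" lam v A r] sol[of "r + 1"] pos[of r] that
    unfolding w_def x_def y_def profile_ivp_def by auto
  \<comment> \<open>At the origin the difference quotient of w is v itself, so its limit is
    v(0).\<close>
  have w'0: "(w has_real_derivative \<mu> / 2) (at 0 within {0..})"
    unfolding has_field_derivative_iff
  proof (rule Lim_transform_eventually)
    show "(v \<longlongrightarrow> \<mu> / 2) (at 0 within {0..})"
      using cv v0 by (auto simp: continuous_on)
    show "\<forall>\<^sub>F r in at 0 within {0..}. v r = (w r - w 0) / (r - 0)"
      by (auto simp: eventually_at_filter w_def)
  qed
  have h': "(h has_real_derivative 2 * (w r * x r)) (at r within {0..})" if "r \<in> {0..}" for r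
  proof -
    have "(w has_real_derivative x r) (at r within {0..})"
      using w'[of r] w'0 x0 that by (cases "r = 0") (auto intro: has_field_derivative_at_within)
    then show ?thesis
      unfolding h_def by (auto intro!: derivative_eq_intros)
  qed
  have h'_at: "(h has_real_derivative 2 * (w r * x r)) (at r)" if "r > 0" for r
    unfolding h_def using that by (auto intro!: derivative_eq_intros w')
  have h'': "((\<lambda>r. 2 * (w r * x r)) has_real_derivative 2 * (x r * x r + w r * y r)) (at r)" if "r > 0" for r
    using that by (auto intro!: derivative_eq_intros w' x')
  have "continuous_on {0<..} w" "continuous_on {0<..} x"
    using cw cx by (auto elim!: continuous_on_subset)
  moreover from this have "continuous_on {0<..} y"
    unfolding y_def using pos by (intro continuous_intros) (auto simp: less_imp_neq[symmetric])
  ultimately have "Ck_on 0 {0<..} (\<lambda>r. 2 * (x r * x r + w r * y r))"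
    by (auto intro!: continuous_intros)
  then have "Ck_on (Suc 0) {0<..} (\<lambda>r. 2 * (w r * x r))"
    by (intro Ck_on_SucI[where f' = "\<lambda>r. 2 * (x r * x r + w r * y r)"]
        has_field_derivative_at_within[OF h''] at_within_half_line_neq_bot(2)) auto
  then have "Ck_on (Suc (Suc 0)) {0<..} h"
    by (intro Ck_on_SucI[where f' = "\<lambda>r. 2 * (w r * x r)" and f = h]
        has_field_derivative_at_within[OF h'_at] at_within_half_line_neq_bot(2)) auto
  moreover have "Ck_on (Suc 0) {0..} h"
    by (intro Ck_on_SucI[OF h'] at_within_half_line_neq_bot) (auto intro!: continuous_intros cw cx)
  moreover have "2 * r^2 * h r * deriv (deriv h) r = m * h r * (h r - 1) + r * deriv h r * (r * deriv h r - lam * r - m)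
      \<and> h r > 0" if "r > 0" for r
  proof -
    have d: "deriv h s = 2 * (w s * x s)" if "s > 0" for s
      using h'_at[OF that] by (rule DERIV_imp_deriv)
    have "(deriv h has_real_derivative 2 * (x r * x r + w r * y r)) (at r)"
      by (rule has_field_derivative_transform_within_open[OF h''[OF that], of "{0<..}"]) (use that d in auto)
    then have "deriv (deriv h) r = 2 * (x r * x r + w r * y r)" by (rule DERIV_imp_deriv)
    then show ?thesis
      using profile_equation_square_iff[of r "w r" "x r" "y r" m lam] pos[of r] that d[OF that]
      by (simp add: h_def y_def)
  qed
  moreover have "h 0 = 1" by (simp add: h_def w_def)
  moreover have "(h has_real_derivative \<mu>) (at 0 within {0..})"
    using h'[of 0] x0 by (simp add: w_def)
  ultimately have "profile_solution lam \<mu> n h"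
    using assms(1) by (simp add: profile_solution_def numeral_2_eq_2)
  then show ?thesis by (simp add: h_def[abs_def] w_def)
qed

text \<open>Taking w = sqrt g reverses the substitution, so uniqueness for the singular problem
  covers every solution in the stated class.\<close>

lemma profile_solution_imp_ivp:
  assumes "of_int n - 1 = m" "m > 0" and g: "profile_solution lam \<mu> n g"
  obtains v A where "\<And>r. r \<ge> 0 \<Longrightarrow> g r = (1 + r * v r)\<^sup>2"
    and "\<And>R. R > 0 \<Longrightarrow> profile_ivp m lam (\<mu> / 2) R v A"
proof -
  define w where "w r = sqrt (g r)" for r
  \<comment> \<open>At r = 0 both v and x receive their limit \<mu>/2, in place of a division by
    zero or a two-sided derivative.\<close>
  define v where "v r = (if r = 0 then \<mu> / 2 else (w r - 1) / r)" for r
  define x where "x r = (if r = 0 then \<mu> / 2 else deriv g r / (2 * w r))" for r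
  define A where "A r = x r + m / 2 * v r" for r
  have C2: "Ck_on (Suc (Suc 0)) {0<..} g" and C1: "Ck_on (Suc 0) {0..} g"
    and g0: "g 0 = 1" and g'0: "(g has_real_derivative \<mu>) (at 0 within {0..})"
    using g by (auto simp: profile_solution_def numeral_2_eq_2)
  have eq: "2 * r^2 * g r * deriv (deriv g) r =
      m * g r * (g r - 1) + r * deriv g r * (r * deriv g r - lam * r - m)" and gpos: "g r > 0" if "r > 0" for r
    using g that assms(1) by (auto simp: profile_solution_def)
  have wpos: "w r > 0" if "r \<ge> 0" for r
    using gpos[of r] g0 that by (cases "r = 0") (auto simp: w_def)
  have g_eq: "g r = (w r)\<^sup>2" if "r \<ge> 0" for r
    using gpos[of r] g0 that by (cases "r = 0") (auto simp: w_def)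
  have w0: "w 0 = 1" by (simp add: w_def g0)
  have w_eq: "w r = 1 + r * v r" for r by (simp add: v_def w0)
  have cg: "continuous_on {0..} g"
    using C1 by (auto intro: differentiable_imp_continuous_on)
  then have cw: "continuous_on {0..} w" unfolding w_def by (intro continuous_intros)
  have w'0: "(w has_real_derivative \<mu> / 2) (at 0 within {0..})"
    unfolding w_def by (rule DERIV_cong[OF DERIV_chain'[OF g'0 DERIV_real_sqrt]]) (auto simp: g0)
  have cv: "continuous_on {0..} v"
    unfolding continuous_on_eq_continuous_within
  proof
    fix r :: real assume r: "r \<in> {0..}"
    show "continuous (at r within {0..}) v"
    proof (cases "r = 0")
      case True
      have "((\<lambda>r. (w r - w 0) / (r - 0)) \<longlongrightarrow> \<mu> / 2) (at 0 within {0..})"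
        using w'0 unfolding has_field_derivative_iff .
      then have "(v \<longlongrightarrow> \<mu> / 2) (at 0 within {0..})"
        by (rule Lim_transform_eventually) (auto simp: eventually_at_filter v_def w0)
      then show ?thesis using True by (simp add: continuous_within v_def)
    next
      case False
      have "continuous (at r within {0..}) (\<lambda>r. (w r - 1) / r)"
        using cw r False by (auto intro!: continuous_intros simp: continuous_on_eq_continuous_within)
      then show ?thesis
        by (rule continuous_transform_within[where \<delta> = r]) (use r False in \<open>auto simp: v_def dist_real_def\<close>)
    qed
  qed
  have g': "(g has_real_derivative deriv g r) (at r)"
    and g'': "(deriv g has_real_derivative deriv (deriv g) r) (at r)" if "r > 0" for r
    using Ck_on_SucD(1)[OF C2] Ck_on_SucD(1)[OF Ck_on_SucD(2)[OF C2]] that by auto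
  \<comment> \<open>The derivative within the closed half-line is \<mu> at 0 and
    \<open>deriv g\<close> elsewhere. Its continuity, part of the C^1 hypothesis, gives continuity
    of x at the origin.\<close>
  define g1 where "g1 r = vector_derivative g (at r within {0..})" for r
  have g1: "g1 r = (if r = 0 then \<mu> else deriv g r)" if "r \<ge> 0" for r
  proof -
    have "(g has_real_derivative (if r = 0 then \<mu> else deriv g r)) (at r within {0..})"
      using g'[of r] g'0 that by (auto intro: has_field_derivative_at_within)
    then show ?thesis
      unfolding g1_def using that
      by (intro vector_derivative_within at_within_half_line_neq_bot)
         (auto simp: has_real_derivative_iff_has_vector_derivative)
  qed
  have "continuous_on {0..} g1" using C1 by (simp add: g1_def[abs_def])
  then have "continuous_on {0..} (\<lambda>r. g1 r / (2 * w r))"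
    using wpos by (intro continuous_intros cw) (auto simp: less_imp_neq[symmetric])
  then have cx: "continuous_on {0..} x"
    by (rule continuous_on_eq) (auto simp: g1 x_def w0)
  have cA: "continuous_on {0..} A" unfolding A_def by (intro continuous_intros cx cv)
  have w': "(w has_real_derivative x r) (at r)" if "r > 0" for r
    unfolding w_def
    by (rule DERIV_cong[OF DERIV_chain'[OF g'[OF that] DERIV_real_sqrt[OF gpos[OF that]]]])
       (use that in \<open>auto simp: x_def w_def field_simps\<close>)
  have v': "(v has_real_derivative (x r - v r) / r) (at r)" if "r > 0" for r
  proof -
    have "((\<lambda>r. (w r - 1) / r) has_real_derivative (x r - v r) / r) (at r)"
      using that by (auto intro!: derivative_eq_intros w' simp: v_def field_simps)
    then show ?thesis
      by (rule has_field_derivative_transform_within_open[of _ _ _ "{0<..}"]) (use that in \<open>auto simp: v_def\<close>)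
  qed
  have x': "(x has_real_derivative
      m * (w r - 1 / w r) / (4 * r\<^sup>2) - (lam / 2 + m / (2 * r)) * x r / (w r)\<^sup>2) (at r)" if "r > 0" for r
  proof -
    \<comment> \<open>This y is solved from g'' = 2 (x^2 + w y), so that the equation for g takes
      the form of \<open>profile_equation_square_iff\<close>; the quotient rule identifies it with
      x'.\<close>
    define y where "y = (deriv (deriv g) r / 2 - x r * x r) / w r"
    have gx: "deriv g r = 2 * (w r * x r)" using that wpos[of r] by (simp add: x_def)
    have gy: "deriv (deriv g) r = 2 * (x r * x r + w r * y)"
      using that wpos[of r] by (simp add: y_def)
    have "((\<lambda>r. deriv g r / (2 * w r)) has_real_derivative
        (deriv (deriv g) r * (2 * w r) - deriv g r * (2 * x r)) / ((2 * w r) * (2 * w r))) (at r)"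
      using that wpos[of r] by (auto intro!: derivative_eq_intros g'' w')
    also have "(deriv (deriv g) r * (2 * w r) - deriv g r * (2 * x r)) / ((2 * w r) * (2 * w r)) = y"
      unfolding gx gy using wpos[of r] that by (simp add: field_simps)
    finally have "(x has_real_derivative y) (at r)"
      by (rule has_field_derivative_transform_within_open[of _ _ _ "{0<..}"]) (use that in \<open>auto simp: x_def\<close>)
    moreover have "y = m * (w r - 1 / w r) / (4 * r\<^sup>2) - (lam / 2 + m / (2 * r)) * x r / (w r)\<^sup>2"
      using eq[OF that] that wpos[of r]
      unfolding gx gy g_eq[OF less_imp_le[OF that]] by (subst (asm) profile_equation_square_iff) auto
    ultimately show ?thesis by simp
  qed
  have A': "(A has_real_derivative profile_rhs m lam r (v r) (A r)) (at r)" if "r > 0" for r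
  proof -
    define y where "y = m * (w r - 1 / w r) / (4 * r\<^sup>2) - (lam / 2 + m / (2 * r)) * x r / (w r)\<^sup>2"
    have "(A has_real_derivative y + m / 2 * ((x r - v r) / r)) (at r)"
      unfolding A_def y_def by (intro DERIV_add DERIV_cmult x' v' that)
    moreover have "profile_rhs m lam r (v r) (A r) = profile_rhs_poly m lam (v r) (x r) (1 / w r)"
      by (simp add: profile_rhs_def A_def w_eq)
    moreover have "v r = (w r - 1) / r" using that by (simp add: v_def)
    then have "profile_rhs_poly m lam (v r) (x r) (1 / w r) - m / 2 * ((x r - v r) / r) = y"
      using profile_rhs_poly_eq[of r "w r" m lam "x r"] wpos[of r] that by (simp only: y_def)
    ultimately show ?thesis by (metis add_diff_cancel_right' diff_add_cancel)
  qed
  have "profile_ivp m lam (\<mu> / 2) R v A" if "R > 0" for R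
    unfolding profile_ivp_def singular_ivp_def mean_solution_def
  proof (intro conjI allI impI ballI)
    show "continuous_on {0..R} A" "continuous_on {0..R} v"
      using cA cv by (auto elim: continuous_on_subset)
    show "A 0 = (1 + m / 2) * (\<mu> / 2)" by (simp add: A_def x_def v_def algebra_simps)
    moreover have "1 + m / 2 \<noteq> 0" using \<open>m > 0\<close> by simp
    ultimately show "v 0 = A 0 / (1 + m / 2)" by (simp add: v_def)
    show "(v has_real_derivative (A r - (1 + m / 2) * v r) / r) (at r)" if "0 < r" for r
      using v'[OF that] by (simp add: A_def algebra_simps)
    show "(A has_real_derivative profile_rhs m lam r (v r) (A r)) (at r)" if "0 < r" for r
      using A'[OF that] .
    show "0 < 1 + r * v r" if "r \<in> {0..R}" for r using wpos[of r] w_eq[of r] that by simp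
  qed
  moreover have "g r = (1 + r * v r)\<^sup>2" if "r \<ge> 0" for r using g_eq[OF that] w_eq[of r] by simp
  ultimately show thesis using that by blast
qed

theorem theorem1p1:
  fixes lam \<mu>\<^sub>1 :: real and n :: int
  assumes "lam \<ge> 0" and "2 \<le> n" and "n \<le> 4"
  shows "\<exists>h. profile_solution lam \<mu>\<^sub>1 n h \<and>
           (\<forall>g. profile_solution lam \<mu>\<^sub>1 n g \<longrightarrow> (\<forall>r\<ge>0. g r = h r))"
proof -
  define m :: real where "m = of_int n - 1"
  have m: "of_int n - 1 = m" "m > 0" using \<open>2 \<le> n\<close> by (auto simp: m_def)
  obtain v A where sol: "\<And>R. R > 0 \<Longrightarrow> profile_ivp m lam (\<mu>\<^sub>1 / 2) R v A"
    using profile_ivp_global[OF m(2) \<open>lam \<ge> 0\<close>] by blast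
  show ?thesis
  proof (intro exI conjI allI impI)
    show "profile_solution lam \<mu>\<^sub>1 n (\<lambda>r. (1 + r * v r)\<^sup>2)"
      by (rule profile_solution_of_ivp[OF m sol])
    fix g and r :: real assume g: "profile_solution lam \<mu>\<^sub>1 n g" and "0 \<le> r"
    obtain w B where w: "\<And>r. r \<ge> 0 \<Longrightarrow> g r = (1 + r * w r)\<^sup>2"
      "\<And>R. R > 0 \<Longrightarrow> profile_ivp m lam (\<mu>\<^sub>1 / 2) R w B"
      using profile_solution_imp_ivp[OF m g] by blast
    \<comment> \<open>Both pairs solve the problem on [0, r + 1] with the same initial parameter, so
      uniqueness on a finite interval decides the value at r.\<close>
    have "w r = v r"
      using profile_ivp_unique(1)[OF _ w(2)[of "r + 1"] sol[of "r + 1"], of r] m(2) \<open>0 \<le> r\<close> by simp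
    then show "g r = (1 + r * v r)\<^sup>2" using w(1) \<open>0 \<le> r\<close> by simp
  qed
qed

end
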